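(* Let $P\subset[0,1]^2$ be a finite nonempty set of points and $L$ a finite nonempty set of lines in $\mathbb R^2$. Then for every $w>0$, $$|B(w;P,L)-B(w/10;P,L)| \lesssim \left(\frac{M_P(w\times w)}{|P|}\,\frac{M_L(w\times 1)}{|L|}\,w^{-3}\right)^{1/2},$$ where the implied constant is absolute (depending only on the fixed bump function $\chi$ below).
   Context: Fix a radially symmetric smooth bump function $\chi:\mathbb R^2\to\mathbb R_{\ge0}$ with $\int\chi=1$ and $\operatorname{supp}\chi\subset B(0,1/50)$, and let $\chi_r(x)=r^{-2}\chi(r^{-1}x)$. Define $\eta:\mathbb R\to[0,1]$ by $\eta(t)=\int_{-1/2}^{1/2}\int_{-\infty}^{\infty}(\chi*\chi_{1/10})(t+r,s)\,ds\,dr$ (so $\eta=1$ on $[-2/5,2/5]$ and $\operatorname{supp}\eta\subset[-3/5,3/5]$). Smoothed incidences: $I(w;P,L)=\sum_{(p,\ell)\in P\times L}\eta(w^{-1}d(p,\ell))$, where $d(p,\ell)$ is the distance from $p$ to $\ell$; normalized incidences $B(w;P,L)=\frac{I(w;P,L)}{w|P||L|}$. A $w$-tube is the open strip of points at distance $<w/2$ from some line. For a tube $T$, a line $\ell$ is said to be contained in $T$ if $\ell\cap[0,1]^2\subset T$. $M_P(w\times w)=\max_Q|P\cap Q|$ over all $w\times w$ squares $Q$, and $M_L(w\times1)=\max_T\#\{\ell\in L:\ell\cap[0,1]^2\subset T\}$ over all $w$-tubes $T$.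
   Formalization: The implied constant is uniform only for 0 < w ≤ W, for each W > 0, and may depend on W as well as χ (W = 1 gives the absolute constant); for one point on one line the left side is 9/w and the right side C·w^(-3/2), so no single constant works for all w > 0. *)

theory Defs
  imports "HOL-Analysis.Analysis"
begin

text \<open>The norm and the inner product on \<open>real \<times> real\<close> are the Euclidean ones.\<close>

type_synonym plane = "real \<times> real"

definition unit_square :: "plane set" where
  "unit_square = {0..1} \<times> {0..1}"

primrec continuously_differentiable ::
  "nat \<Rightarrow> ('a::real_normed_vector \<Rightarrow> 'b::real_normed_vector) \<Rightarrow> bool" where
  "continuously_differentiable 0 f \<longleftrightarrow> continuous_on UNIV f"
| "continuously_differentiable (Suc k) f \<longleftrightarrow>
     f differentiable_on UNIV \<and>
     (\<forall>v. continuously_differentiable k (\<lambda>x. frechet_derivative f (at x) v))"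

definition smooth :: "('a::real_normed_vector \<Rightarrow> 'b::real_normed_vector) \<Rightarrow> bool" where
  "smooth f \<longleftrightarrow> (\<forall>k. continuously_differentiable k f)"

definition radial_bump :: "(plane \<Rightarrow> real) \<Rightarrow> bool" where
  "radial_bump \<phi> \<longleftrightarrow>
     smooth \<phi> \<and>
     (\<forall>x. 0 \<le> \<phi> x) \<and>
     (\<forall>x y. norm x = norm y \<longrightarrow> \<phi> x = \<phi> y) \<and>
     closure {x. \<phi> x \<noteq> 0} \<subseteq> ball 0 (1 / 50) \<and>
     (LINT x|lborel. \<phi> x) = 1"

definition rescale :: "(plane \<Rightarrow> real) \<Rightarrow> real \<Rightarrow> plane \<Rightarrow> real" where
  "rescale \<phi> r x = r powi (-2) * \<phi> (inverse r *\<^sub>R x)"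

definition convolve :: "(plane \<Rightarrow> real) \<Rightarrow> (plane \<Rightarrow> real) \<Rightarrow> plane \<Rightarrow> real" where
  "convolve f g x = (LINT y|lborel. f y * g (x - y))"

definition eta :: "(plane \<Rightarrow> real) \<Rightarrow> real \<Rightarrow> real" where
  "eta \<phi> t =
     (LINT r:{-1/2..1/2}|lborel. LINT s|lborel. convolve \<phi> (rescale \<phi> (1 / 10)) (t + r, s))"

definition is_line :: "plane set \<Rightarrow> bool" where
  "is_line l \<longleftrightarrow> affine l \<and> aff_dim l = 1"

definition incidences :: "(plane \<Rightarrow> real) \<Rightarrow> real \<Rightarrow> plane set \<Rightarrow> plane set set \<Rightarrow> real" where
  "incidences \<phi> w P L = (\<Sum>(p, l)\<in>P \<times> L. eta \<phi> (inverse w * infdist p l))"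

definition norm_incidences :: "(plane \<Rightarrow> real) \<Rightarrow> real \<Rightarrow> plane set \<Rightarrow> plane set set \<Rightarrow> real" where
  "norm_incidences \<phi> w P L = incidences \<phi> w P L / (w * real (card P) * real (card L))"

definition is_tube :: "real \<Rightarrow> plane set \<Rightarrow> bool" where
  "is_tube w T \<longleftrightarrow> (\<exists>l. is_line l \<and> T = {x. infdist x l < w / 2})"

text \<open>Squares are closed and may have any orientation.\<close>

definition is_square :: "real \<Rightarrow> plane set \<Rightarrow> bool" where
  "is_square w Q \<longleftrightarrow>
     (\<exists>a u v. norm u = 1 \<and> norm v = 1 \<and> u \<bullet> v = 0 \<and>
        Q = {a + s *\<^sub>R u + t *\<^sub>R v | s t. s \<in> {0..w} \<and> t \<in> {0..w}})"

definition max_points :: "plane set \<Rightarrow> real \<Rightarrow> nat" where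
  "max_points P w = Max {card (P \<inter> Q) | Q. is_square w Q}"

text \<open>A line missing the unit square lies in every tube, so it is always counted here.\<close>

definition max_lines :: "plane set set \<Rightarrow> real \<Rightarrow> nat" where
  "max_lines L w = Max {card {l \<in> L. l \<inter> unit_square \<subseteq> T} | T. is_tube w T}"

text \<open>
  Comparing \<open>norm_incidences\<close> at the scales \<open>w\<close> and \<open>w / 10\<close>, no bound by
  \<open>C * sqrt (max_points P w / card P * (max_lines L w / card L) * w powi (-3))\<close> can hold for all
  \<open>w > 0\<close> with a single \<open>C\<close>: for one point on one line, the difference is \<open>9 / w\<close> and the bound is
  \<open>C * w powr (-3/2)\<close>. The constant can only be uniform over bounded ranges \<open>0 < w \<le> W\<close>.
\<close>

end

theory Submission
  imports Defs
begin

text \<open>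
  With \<open>k u = eta u - 10 * eta (10 * u)\<close>, the difference of the normalized incidences is the sum of
  \<open>k (d (p, l) / w)\<close> over all pairs, divided by \<open>w |P| |L|\<close>. The profile \<open>k\<close> is even, \<open>C\<^sup>2\<close>,
  compactly supported and has integral \<open>0\<close>. Split the lines into graphs \<open>y = t x + c\<close> and
  \<open>x = t y + c\<close> with \<open>|t| \<le> 1\<close>, and let \<open>G\<close> be the sum over one class of lines, as a function of
  the point. A Sobolev inequality bounds \<open>G p ^ 2\<close> by the average over a box of side \<open>w\<close> at \<open>p\<close> of the
  squares of \<open>G\<close> and of its rescaled derivatives, and a point of the plane lies in at most
  \<open>max_points P w\<close> of these boxes. It remains to bound the weighted \<open>L\<^sup>2\<close> norm of such sums. As the
  profiles have mean zero, the waves of two lines with slopes differing by \<open>D\<close> are almost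
  orthogonal: their inner product is \<open>O (w min (1, (w / D) ^ 3))\<close>. Only \<open>O ((D / w) ^ 2)\<close> cells of
  size \<open>w\<close> in the space of lines contain lines that cross a given line at such an angle, each cell
  contributes at most \<open>max_lines L w\<close> lines, and the resulting series converges.
\<close>

section \<open>Integration\<close>

lemma integrable_continuous_compact_support:
  fixes f :: "'a::euclidean_space \<Rightarrow> real"
  assumes "continuous_on UNIV f" "compact S" "\<And>x. x \<notin> S \<Longrightarrow> f x = 0"
  shows "integrable lborel f"
proof -
  have "integrable lborel (\<lambda>x. indicator S x *\<^sub>R f x)"
    by (rule borel_integrable_compact[OF assms(2)]) (rule continuous_on_subset[OF assms(1)], simp)
  also have "(\<lambda>x. indicator S x *\<^sub>R f x) = f"
    using assms(3) by (auto simp: indicator_def fun_eq_iff)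
  finally show ?thesis .
qed

lemma lborel_integral_iterated:
  fixes f :: "real \<times> real \<Rightarrow> real"
  assumes "integrable lborel f"
  shows "(LINT z|lborel. f z) = (LINT x|lborel. LINT y|lborel. f (x, y))"
    and "(LINT z|lborel. f z) = (LINT y|lborel. LINT x|lborel. f (x, y))"
    and "integrable lborel (\<lambda>x. LINT y|lborel. f (x, y))"
    and "integrable lborel (\<lambda>y. LINT x|lborel. f (x, y))"
proof -
  have i: "integrable (lborel \<Otimes>\<^sub>M lborel) f"
    using assms by (simp add: lborel_prod)
  have i': "integrable (lborel \<Otimes>\<^sub>M lborel) (case_prod (\<lambda>x y. f (x, y)))"
    using i by simp
  show "(LINT z|lborel. f z) = (LINT x|lborel. LINT y|lborel. f (x, y))"
    using lborel_pair.integral_fst'[OF i] by (simp add: lborel_prod)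
  show "(LINT z|lborel. f z) = (LINT y|lborel. LINT x|lborel. f (x, y))"
    using lborel_pair.integral_snd[OF i'] by (simp add: lborel_prod)
  show "integrable lborel (\<lambda>x. LINT y|lborel. f (x, y))"
    using lborel_pair.integrable_fst'[OF i] .
  show "integrable lborel (\<lambda>y. LINT x|lborel. f (x, y))"
    using lborel_pair.integrable_snd[OF i'] by simp
qed

text \<open>No integrability is assumed: the Bochner integral of a non-integrable function is \<open>0\<close>.\<close>

lemma lborel_integral_abs_le_support:
  fixes f :: "real \<Rightarrow> real"
  assumes "0 \<le> B" "0 \<le> r"
    and "\<And>u. \<bar>u - c\<bar> \<le> r \<Longrightarrow> \<bar>f u\<bar> \<le> B"
    and "\<And>u. \<bar>u - c\<bar> > r \<Longrightarrow> f u = 0"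
  shows "\<bar>LINT u|lborel. f u\<bar> \<le> 2 * r * B"
proof (cases "integrable lborel f")
  case True
  have "\<bar>LINT u|lborel. f u\<bar> \<le> (LINT u|lborel. \<bar>f u\<bar>)"
    by (rule integral_abs_bound)
  also have "\<dots> \<le> (LINT u|lborel. B * indicator {c - r..c + r} u)"
  proof (rule integral_mono)
    show "integrable lborel (\<lambda>u. B * indicator {c - r..c + r} u)"
      using assms(2) by (intro integrable_mult_right) (simp add: integrable_indicator_iff)
    fix u show "\<bar>f u\<bar> \<le> B * indicator {c - r..c + r} u"
    proof (cases "\<bar>u - c\<bar> \<le> r")
      case True
      then have "u \<in> {c - r..c + r}" by auto
      then show ?thesis using assms(3)[OF True] by simp
    next
      case False
      then show ?thesis using assms(1) assms(4)[of u] by simp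
    qed
  qed (use True in simp)
  also have "\<dots> = 2 * r * B" using assms(2) by simp
  finally show ?thesis .
next
  case False
  then show ?thesis using assms(1,2) by (simp add: not_integrable_integral_eq)
qed

lemma lborel_integral_affine_image:
  fixes f :: "real \<Rightarrow> real"
  assumes "a \<noteq> 0"
  shows "(LINT x|lborel. f (b + a * x)) = (LINT v|lborel. f v) / \<bar>a\<bar>"
  using lborel_integral_real_affine[OF assms, of f b] assms by (simp add: field_simps)

text \<open>The fundamental theorem of calculus on \<open>{-2..2}\<close>, whose endpoints lie
  outside the support of \<open>f\<close>. This supplies the vanishing means of the first two
  derivatives of the kernel.\<close>

lemma lborel_integral_derivative_eq_0:
  fixes f f' :: "real \<Rightarrow> real"
  assumes d: "\<And>x. (f has_real_derivative f' x) (at x)"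
    and c: "continuous_on UNIV f'"
    and s: "\<And>x. \<bar>x\<bar> > 1 \<Longrightarrow> f x = 0" and s': "\<And>x. \<bar>x\<bar> > 1 \<Longrightarrow> f' x = 0"
  shows "(LINT x|lborel. f' x) = 0"
proof -
  have "(f' has_integral (f 2 - f (- 2))) {-2..2}"
    by (rule fundamental_theorem_of_calculus)
      (auto intro!: has_field_derivative_at_within d
        simp: has_real_derivative_iff_has_vector_derivative[symmetric])
  then have h: "integral {-2..2} f' = 0" using s by (simp add: integral_unique)
  have "set_integrable lborel {-2..2} f'"
    by (rule borel_integrable_atLeastAtMost') (rule continuous_on_subset[OF c], simp)
  from set_borel_integral_eq_integral(2)[OF this] h
  have "(LINT x:{-2..2}|lborel. f' x) = 0" by simp
  also have "(LINT x:{-2..2}|lborel. f' x) = (LINT x|lborel. f' x)"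
    unfolding set_lebesgue_integral_def
  proof (rule Bochner_Integration.integral_cong[OF refl])
    fix x show "indicator {-2..2} x *\<^sub>R f' x = f' x"
      using s'[of x] by (cases "\<bar>x\<bar> > 1") (auto simp: indicator_def)
  qed
  finally show ?thesis .
qed

lemma derivative_eq_0_outside:
  fixes f :: "real \<Rightarrow> real"
  assumes "(f has_real_derivative d) (at x)" "\<And>x. \<bar>x\<bar> > 1 \<Longrightarrow> f x = 0" "\<bar>x\<bar> > 1"
  shows "d = 0"
proof -
  have o: "open {x::real. \<bar>x\<bar> > 1}" by (intro open_Collect_less continuous_intros)
  have "((\<lambda>_. 0) has_real_derivative d) (at x)"
    by (rule has_field_derivative_transform_within_open[OF assms(1) o]) (use assms in auto)
  then show ?thesis using DERIV_unique DERIV_const by blast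
qed

section \<open>Almost orthogonality of waves\<close>

text \<open>A weight supported in \<open>{-R..R}\<close> whose derivative is Lipschitz, which is the
  regularity that a bound on mixed second differences takes. The polynomial form keeps the constants
  explicit.\<close>

definition cutoff :: "real \<Rightarrow> real \<Rightarrow> real" where
  "cutoff R x = (max 0 (R\<^sup>2 - x\<^sup>2))\<^sup>2"

lemma DERIV_max_0_squared:
  "((\<lambda>q::real. (max 0 q)\<^sup>2) has_real_derivative 2 * max 0 q) (at q)"
proof -
  consider "q > 0" | "q < 0" | "q = 0" by linarith
  then show ?thesis
  proof cases
    case 1
    have "((\<lambda>q. q\<^sup>2) has_real_derivative 2 * max 0 q) (at q)"
      using 1 by (auto intro!: derivative_eq_intros)
    then show ?thesis
      by (rule has_field_derivative_transform_within_open[of _ _ _ "{0<..}"]) (use 1 in auto)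
  next
    case 2
    have "((\<lambda>q. 0) has_real_derivative 2 * max 0 q) (at q)"
      using 2 by (auto intro!: derivative_eq_intros)
    then show ?thesis
      by (rule has_field_derivative_transform_within_open[of _ _ _ "{..<0}"]) (use 2 in auto)
  next
    case 3
    \<comment> \<open>At the kink the difference quotient is \<open>0\<close> for negative
      \<open>h\<close> and \<open>h\<close> for positive \<open>h\<close>.\<close>
    have "((\<lambda>h::real. (max 0 h)\<^sup>2 / h) \<longlongrightarrow> 0) (at 0)"
    proof (rule Lim_null_comparison)
      show "\<forall>\<^sub>F h in at (0::real). norm ((max 0 h)\<^sup>2 / h) \<le> \<bar>h\<bar>"
        by (auto simp: eventually_at_filter max_def power2_eq_square)
      show "((\<lambda>h::real. \<bar>h\<bar>) \<longlongrightarrow> 0) (at 0)"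
        by (rule tendsto_rabs_zero) simp
    qed
    then show ?thesis using 3 by (simp add: DERIV_def)
  qed
qed

lemma DERIV_cutoff:
  "(cutoff R has_real_derivative - 4 * (x * max 0 (R\<^sup>2 - x\<^sup>2))) (at x)"
proof -
  have "((\<lambda>x. R\<^sup>2 - x\<^sup>2) has_real_derivative - 2 * x) (at x)"
    by (auto intro!: derivative_eq_intros)
  from DERIV_chain2[OF DERIV_max_0_squared this] show ?thesis
    unfolding cutoff_def by (simp add: algebra_simps)
qed

text \<open>The function is the cubic \<open>a * (R ^ 2 - a ^ 2)\<close> composed with the clamp
  \<open>c\<close> to the interval from \<open>- R\<close> to \<open>R\<close>, because the cubic
  vanishes at both ends. The clamp is 1-Lipschitz, and the difference quotient of the cubic on that
  interval is at most \<open>4 * R ^ 2\<close>.\<close>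

lemma cutoff_derivative_lipschitz:
  fixes R x y :: real
  assumes "0 \<le> R"
  shows "\<bar>x * max 0 (R\<^sup>2 - x\<^sup>2) - y * max 0 (R\<^sup>2 - y\<^sup>2)\<bar> \<le> 4 * R\<^sup>2 * \<bar>x - y\<bar>"
proof -
  define c where "c x = max (- R) (min R x)" for x
  have e: "x * max 0 (R\<^sup>2 - x\<^sup>2) = c x * (R\<^sup>2 - (c x)\<^sup>2)" for x
  proof (cases "\<bar>x\<bar> \<le> R")
    case True
    then have "x\<^sup>2 \<le> R\<^sup>2" by (simp add: abs_le_square_iff[symmetric])
    moreover have "c x = x" using True unfolding c_def by auto
    ultimately show ?thesis by simp
  next
    case False
    then have "R\<^sup>2 \<le> x\<^sup>2" using assms by (simp add: abs_le_square_iff[symmetric])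
    moreover have "c x = R \<or> c x = - R" using False assms unfolding c_def by auto
    then have "(c x)\<^sup>2 = R\<^sup>2" by auto
    ultimately show ?thesis by simp
  qed
  define a b where "a = c x" and "b = c y"
  have ab: "\<bar>a\<bar> \<le> R" "\<bar>b\<bar> \<le> R" using assms unfolding a_def b_def c_def by auto
  have l: "\<bar>a - b\<bar> \<le> \<bar>x - y\<bar>" unfolding a_def b_def c_def by linarith
  have "\<bar>R\<^sup>2 - (a\<^sup>2 + a * b + b\<^sup>2)\<bar> \<le> R\<^sup>2 + (\<bar>a\<bar>\<^sup>2 + \<bar>a\<bar> * \<bar>b\<bar> + \<bar>b\<bar>\<^sup>2)"
    by (simp add: abs_mult[symmetric]) (smt (verit) zero_le_power2)
  also have "\<dots> \<le> R\<^sup>2 + (R\<^sup>2 + R * R + R\<^sup>2)"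
    using ab assms by (intro add_mono mult_mono power_mono) auto
  also have "\<dots> = 4 * R\<^sup>2" by (simp add: power2_eq_square)
  finally have m: "\<bar>R\<^sup>2 - (a\<^sup>2 + a * b + b\<^sup>2)\<bar> \<le> 4 * R\<^sup>2" .
  have "a * (R\<^sup>2 - a\<^sup>2) - b * (R\<^sup>2 - b\<^sup>2) = (R\<^sup>2 - (a\<^sup>2 + a * b + b\<^sup>2)) * (a - b)"
    by (simp add: algebra_simps power2_eq_square)
  then have "\<bar>a * (R\<^sup>2 - a\<^sup>2) - b * (R\<^sup>2 - b\<^sup>2)\<bar> = \<bar>R\<^sup>2 - (a\<^sup>2 + a * b + b\<^sup>2)\<bar> * \<bar>a - b\<bar>"
    by (simp add: abs_mult)
  also have "\<dots> \<le> (4 * R\<^sup>2) * \<bar>x - y\<bar>" using m l by (intro mult_mono) auto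
  finally show ?thesis unfolding e a_def b_def .
qed

text \<open>The mean value inequality in the increment \<open>h\<close>, applied to
  \<open>g s = cutoff R (s + k) - cutoff R s\<close>. Its derivative is 4 times a difference bounded
  by the Lipschitz estimate, whence \<open>16 * R ^ 2\<close>.\<close>

lemma cutoff_mixed_difference:
  assumes "0 \<le> R"
  shows "\<bar>cutoff R (x + h + k) - cutoff R (x + h) - (cutoff R (x + k) - cutoff R x)\<bar>
    \<le> 16 * R\<^sup>2 * \<bar>h\<bar> * \<bar>k\<bar>"
proof -
  define g where "g s = cutoff R (s + k) - cutoff R s" for s
  define g' where "g' s = - 4 * ((s + k) * max 0 (R\<^sup>2 - (s + k)\<^sup>2)) - (- 4 * (s * max 0 (R\<^sup>2 - s\<^sup>2)))" for s
  have d: "(g has_real_derivative g' s) (at s)" for s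
  proof -
    have "((\<lambda>s. cutoff R (s + k)) has_real_derivative - 4 * ((s + k) * max 0 (R\<^sup>2 - (s + k)\<^sup>2))) (at s)"
      using DERIV_cutoff[of R "s + k"] by (simp add: DERIV_shift)
    from DERIV_diff[OF this DERIV_cutoff[of R s]] show ?thesis
      unfolding g_def g'_def .
  qed
  have b: "norm (g' s) \<le> 16 * R\<^sup>2 * \<bar>k\<bar>" for s
    using cutoff_derivative_lipschitz[OF assms, of "s + k" s] unfolding g'_def real_norm_def
    by (simp only: add_diff_cancel_left')
  have "norm (g (x + h) - g x) \<le> 16 * R\<^sup>2 * \<bar>k\<bar> * norm (x + h - x)"
    by (rule field_differentiable_bound[of UNIV]) (use d b in auto)
  then show ?thesis unfolding g_def by (simp add: algebra_simps)
qed

lemma cutoff_nonneg: "0 \<le> cutoff R x"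
  unfolding cutoff_def by simp

lemma cutoff_le: "cutoff R x \<le> R ^ 4"
proof -
  have "(max 0 (R\<^sup>2 - x\<^sup>2))\<^sup>2 \<le> (R\<^sup>2)\<^sup>2" by (intro power_mono) auto
  then show ?thesis unfolding cutoff_def by simp
qed

lemma cutoff_eq_0: "0 \<le> R \<Longrightarrow> \<bar>x\<bar> > R \<Longrightarrow> cutoff R x = 0"
  unfolding cutoff_def using abs_le_square_iff[of R x] by simp

lemma cutoff_ge_1:
  assumes "2 \<le> R" "\<bar>x\<bar> \<le> R / 2"
  shows "1 \<le> cutoff R x"
proof -
  have "x\<^sup>2 \<le> (R / 2)\<^sup>2" using assms abs_le_square_iff[of x "R / 2"] by auto
  moreover have "2\<^sup>2 \<le> R\<^sup>2" using assms by (intro power_mono) auto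
  ultimately have "1 \<le> max 0 (R\<^sup>2 - x\<^sup>2)" by (simp add: power2_eq_square)
  then show ?thesis unfolding cutoff_def by (simp add: one_le_power)
qed

lemma continuous_on_cutoff [continuous_intros]:
  "continuous_on S f \<Longrightarrow> continuous_on S (\<lambda>x. cutoff R (f x))"
  unfolding cutoff_def by (intro continuous_intros)

section \<open>Mean-zero profiles and the inner products of two waves\<close>

text \<open>It will hold for the kernel and for its first two derivatives with a common
  \<open>K\<close>, so that one energy constant serves all three.\<close>

locale mean_zero_profile =
  fixes \<kappa> :: "real \<Rightarrow> real" and K :: real
  assumes cont: "continuous_on UNIV \<kappa>"
    and bound: "\<And>u. \<bar>\<kappa> u\<bar> \<le> K"
    and supp: "\<And>u. \<bar>u\<bar> > 1 \<Longrightarrow> \<kappa> u = 0"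
    and mean: "(LINT u|lborel. \<kappa> u) = 0"
begin

lemma K_nonneg: "0 \<le> K"
  using bound[of 0] by linarith

lemma cont_comp [continuous_intros]: "continuous_on S f \<Longrightarrow> continuous_on S (\<lambda>x. \<kappa> (f x))"
  by (rule continuous_on_compose2[OF cont]) auto

lemma supp_scaled: "0 < a \<Longrightarrow> \<bar>u\<bar> > 1 / a \<Longrightarrow> \<kappa> (a * u) = 0"
  by (rule supp) (simp add: abs_mult field_simps)

lemma mean_scaled: "0 < a \<Longrightarrow> (LINT u|lborel. \<kappa> (a * u)) = 0"
  using lborel_integral_affine_image[of a \<kappa> 0] mean by simp

lemma integrable_scaled:
  assumes "0 < a" "continuous_on UNIV g"
  shows "integrable lborel (\<lambda>u. g u * \<kappa> (a * u))"
proof (rule integrable_continuous_compact_support[of _ "{- (1 / a)..1 / a}"])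
  fix u assume "u \<notin> {- (1 / a)..1 / a}"
  then have "\<bar>u\<bar> > 1 / a" by auto
  then show "g u * \<kappa> (a * u) = 0" using supp_scaled[OF assms(1)] by simp
qed (auto intro!: continuous_intros assms)

text \<open>The integrand of the weighted inner product of two waves. Each wave is constant along
  the lines of its slope and lives on a strip around one line, of vertical half-width
  \<open>1 / a\<close> or \<open>1 / b\<close>.\<close>

definition pairing :: "real \<Rightarrow> real \<Rightarrow> real \<Rightarrow> real \<Rightarrow> real \<Rightarrow> real \<Rightarrow> real \<Rightarrow> plane \<Rightarrow> real" where
  "pairing R a t c b t' c' z =
     cutoff R (fst z) * (\<kappa> (a * (snd z - t * fst z - c)) * \<kappa> (b * (snd z - t' * fst z - c')))"

lemma integrable_pairing:
  assumes "0 < a" "0 < b" "0 \<le> R"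
  shows "integrable lborel (pairing R a t c b t' c')"
proof (rule integrable_continuous_compact_support)
  \<comment> \<open>The weight confines \<open>x\<close> to \<open>{-R..R}\<close>, and over that
    interval the strip of the first profile stays below height \<open>?Y\<close>.\<close>
  let ?Y = "\<bar>t\<bar> * R + \<bar>c\<bar> + 1 / a"
  show "continuous_on UNIV (pairing R a t c b t' c')"
    unfolding pairing_def by (intro continuous_intros)
  show "compact ({-R..R} \<times> {-?Y..?Y})" by (intro compact_Times compact_Icc)
  fix z assume z: "z \<notin> {-R..R} \<times> {-?Y..?Y}"
  show "pairing R a t c b t' c' z = 0"
  proof (cases "\<bar>fst z\<bar> \<le> R")
    case True
    then have "\<bar>snd z\<bar> > ?Y" using z by (cases z) auto
    moreover have "\<bar>t * fst z\<bar> \<le> \<bar>t\<bar> * R" using True by (simp add: abs_mult mult_left_mono)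
    ultimately have "\<bar>snd z - t * fst z - c\<bar> > 1 / a" by linarith
    then show ?thesis unfolding pairing_def using supp_scaled[OF assms(1)] by simp
  next
    case False
    then show ?thesis unfolding pairing_def using cutoff_eq_0[OF assms(3)] by simp
  qed
qed

text \<open>Over the support of the weight the two lines differ in height by at least
  \<open>\<bar>c - c'\<bar> - R * \<bar>t - t'\<bar>\<close>. If this exceeds the sum of the
  half-widths, the strips are disjoint there and the integrand vanishes identically.\<close>

lemma pairing_integral_eq_0:
  assumes "0 < a" "0 < b" "0 \<le> R" "\<bar>c - c'\<bar> > R * \<bar>t - t'\<bar> + 1 / a + 1 / b"
  shows "(LINT z|lborel. pairing R a t c b t' c' z) = 0"
proof -
  have "pairing R a t c b t' c' z = 0" for z
  proof (rule ccontr)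
    assume "pairing R a t c b t' c' z \<noteq> 0"
    then have x: "\<bar>fst z\<bar> \<le> R" and 1: "\<bar>snd z - t * fst z - c\<bar> \<le> 1 / a"
      and 2: "\<bar>snd z - t' * fst z - c'\<bar> \<le> 1 / b"
      unfolding pairing_def using cutoff_eq_0[OF assms(3)] supp_scaled assms(1,2)
      by (force simp: not_less[symmetric])+
    have "\<bar>(t - t') * fst z\<bar> \<le> R * \<bar>t - t'\<bar>"
      using x by (simp add: abs_mult mult.commute mult_right_mono)
    moreover have "(t - t') * fst z = t * fst z - t' * fst z" by (simp add: algebra_simps)
    ultimately show False using 1 2 assms(4) by linarith
  qed
  then show ?thesis by simp
qed

text \<open>Size alone, without cancellation: the integrand is at most \<open>R ^ 4 * K ^ 2\<close>,
  on a set of height \<open>2 / a\<close> over an interval of length \<open>2 * R\<close>. This is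
  the bound for nearly parallel lines.\<close>

lemma pairing_integral_le:
  assumes "0 < a" "0 < b" "0 \<le> R"
  shows "\<bar>LINT z|lborel. pairing R a t c b t' c' z\<bar> \<le> 4 * R ^ 5 * K\<^sup>2 / a"
proof -
  have b0: "\<bar>pairing R a t c b t' c' z\<bar> \<le> R ^ 4 * K\<^sup>2" for z
  proof -
    have "\<bar>pairing R a t c b t' c' z\<bar> = cutoff R (fst z) *
        (\<bar>\<kappa> (a * (snd z - t * fst z - c))\<bar> * \<bar>\<kappa> (b * (snd z - t' * fst z - c'))\<bar>)"
      unfolding pairing_def by (simp add: abs_mult cutoff_nonneg)
    also have "\<dots> \<le> R ^ 4 * (K * K)"
      by (intro mult_mono bound cutoff_le) (auto simp: K_nonneg cutoff_nonneg)
    finally show ?thesis by (simp add: power2_eq_square)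
  qed
  have inner: "\<bar>LINT y|lborel. pairing R a t c b t' c' (x, y)\<bar> \<le> 2 * (1 / a) * (R ^ 4 * K\<^sup>2)" for x
  proof (rule lborel_integral_abs_le_support[of _ _ "t * x + c"])
    fix y assume "\<bar>y - (t * x + c)\<bar> > 1 / a"
    then have "\<bar>y - t * x - c\<bar> > 1 / a" by (simp add: algebra_simps)
    then show "pairing R a t c b t' c' (x, y) = 0"
      unfolding pairing_def using supp_scaled[OF assms(1)] by simp
  qed (use assms b0 in auto)
  have "\<bar>LINT x|lborel. LINT y|lborel. pairing R a t c b t' c' (x, y)\<bar>
      \<le> 2 * R * (2 * (1 / a) * (R ^ 4 * K\<^sup>2))"
  proof (rule lborel_integral_abs_le_support[of _ _ 0])
    fix x assume "\<bar>x - 0\<bar> > R"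
    then have "cutoff R x = 0" using cutoff_eq_0[OF assms(3)] by simp
    then show "(LINT y|lborel. pairing R a t c b t' c' (x, y)) = 0"
      unfolding pairing_def by simp
  qed (use assms inner in auto)
  then show ?thesis
    using lborel_integral_iterated(1)[OF integrable_pairing[OF assms]]
    by (simp add: eval_nat_numeral algebra_simps)
qed

text \<open>
  In the coordinates \<open>u = y - t x - c\<close>, \<open>v = y - t' x - c'\<close> the two profiles separate, so the
  vanishing mean of each of them allows the weight to be replaced by its mixed second difference.
\<close>

lemma pairing_integral_le_transversal:
  assumes a: "0 < a" and b: "0 < b" and R: "0 \<le> R" and t: "t \<noteq> t'"
  shows "\<bar>LINT z|lborel. pairing R a t c b t' c' z\<bar> \<le> 64 * R\<^sup>2 * K\<^sup>2 / (a\<^sup>2 * b\<^sup>2 * \<bar>t - t'\<bar> ^ 3)"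
proof -
  define D E where "D = t - t'" and "E = c - c'"
  have D: "D \<noteq> 0" using t unfolding D_def by simp
  \<comment> \<open>The pairing in the sheared coordinates \<open>(x, u)\<close>. The argument
    \<open>u + D x + E\<close> of the second profile is the coordinate \<open>v\<close>.\<close>
  define F where "F z = cutoff R (fst z) * (\<kappa> (a * snd z) * \<kappa> (b * (snd z + D * fst z + E)))" for z :: plane
  have intF: "integrable lborel F"
  proof (rule integrable_continuous_compact_support)
    show "continuous_on UNIV F" unfolding F_def by (intro continuous_intros)
    show "compact ({-R..R} \<times> {-(1/a)..1/a})" by (intro compact_Times compact_Icc)
    fix z :: plane assume z: "z \<notin> {-R..R} \<times> {-(1/a)..1/a}"
    then have "\<bar>fst z\<bar> > R \<or> \<bar>snd z\<bar> > 1 / a" by (cases z) auto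
    then show "F z = 0"
      unfolding F_def using cutoff_eq_0[OF R] supp_scaled[OF a] by auto
  qed
  \<comment> \<open>\<open>V v u\<close> is the weight at the point with coordinates
    \<open>u\<close> and \<open>v\<close>, since there \<open>x = (v - u - E) / D\<close>.
    \<open>J u\<close> integrates it against the second profile.\<close>
  define V where "V v u = cutoff R ((v - u - E) / D)" for u v
  define J where "J u = (LINT v|lborel. V v u * \<kappa> (b * v))" for u
  have contV: "continuous_on UNIV (\<lambda>v. V v u)" for u
    unfolding V_def by (intro continuous_intros) (use D in auto)
  \<comment> \<open>The change of variable from \<open>x\<close> to \<open>v\<close> has Jacobian
    \<open>1 / \<bar>D\<bar>\<close>, the first of the three powers of
    \<open>1 / \<bar>D\<bar>\<close>.\<close>
  have inner: "(LINT x|lborel. F (x, u)) = \<kappa> (a * u) * J u / \<bar>D\<bar>" for u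
  proof -
    have "(LINT x|lborel. F (x, u)) = (LINT x|lborel. \<kappa> (a * u) * (V (u + E + D * x) u * \<kappa> (b * (u + E + D * x))))"
      unfolding F_def V_def using D by (intro Bochner_Integration.integral_cong) (auto simp: algebra_simps)
    also have "\<dots> = \<kappa> (a * u) * (LINT x|lborel. V (u + E + D * x) u * \<kappa> (b * (u + E + D * x)))"
      by simp
    also have "(LINT x|lborel. V (u + E + D * x) u * \<kappa> (b * (u + E + D * x))) = J u / \<bar>D\<bar>"
      unfolding J_def by (rule lborel_integral_affine_image[OF D, of "\<lambda>v. V v u * \<kappa> (b * v)" "u + E"])
    finally show ?thesis by simp
  qed
  have "(LINT z|lborel. pairing R a t c b t' c' z)
      = (LINT x|lborel. LINT y|lborel. pairing R a t c b t' c' (x, y))"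
    by (rule lborel_integral_iterated(1)[OF integrable_pairing[OF a b R]])
  also have "\<dots> = (LINT x|lborel. LINT u|lborel. F (x, u))"
  proof (rule Bochner_Integration.integral_cong[OF refl])
    fix x
    have "(LINT u|lborel. pairing R a t c b t' c' (x, (t * x + c) + 1 * u))
        = (LINT y|lborel. pairing R a t c b t' c' (x, y)) / \<bar>1\<bar>"
      by (rule lborel_integral_affine_image) simp
    moreover have "pairing R a t c b t' c' (x, (t * x + c) + 1 * u) = F (x, u)" for u
    proof -
      have "(t * x + c) + 1 * u - t * x - c = u" "(t * x + c) + 1 * u - t' * x - c' = u + D * x + E"
        unfolding D_def E_def by (simp_all add: algebra_simps)
      then show ?thesis unfolding pairing_def F_def fst_conv snd_conv by metis
    qed
    ultimately show "(LINT y|lborel. pairing R a t c b t' c' (x, y)) = (LINT u|lborel. F (x, u))"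
      by simp
  qed
  also have "\<dots> = (LINT u|lborel. LINT x|lborel. F (x, u))"
    using lborel_integral_iterated(1,2)[OF intF] by simp
  also have "\<dots> = (LINT u|lborel. \<kappa> (a * u) * J u / \<bar>D\<bar>)"
    by (simp add: inner)
  finally have e1: "(LINT z|lborel. pairing R a t c b t' c' z) = (LINT u|lborel. \<kappa> (a * u) * J u / \<bar>D\<bar>)" .
  have i1: "integrable lborel (\<lambda>u. \<kappa> (a * u) * J u / \<bar>D\<bar>)"
    using lborel_integral_iterated(4)[OF intF] by (simp add: inner)
  have i0: "integrable lborel (\<lambda>u. \<kappa> (a * u))"
    using integrable_scaled[OF a, of "\<lambda>_. 1"] by simp
  \<comment> \<open>The mean of the first profile vanishes, so the constant \<open>J 0\<close> may
    be subtracted from \<open>J u\<close>.\<close>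
  have "(LINT u|lborel. \<kappa> (a * u) * (J u - J 0) / \<bar>D\<bar>)
      = (LINT u|lborel. \<kappa> (a * u) * J u / \<bar>D\<bar> - J 0 / \<bar>D\<bar> * \<kappa> (a * u))"
    by (intro Bochner_Integration.integral_cong) (auto simp: algebra_simps diff_divide_distrib)
  also have "\<dots> = (LINT u|lborel. \<kappa> (a * u) * J u / \<bar>D\<bar>) - J 0 / \<bar>D\<bar> * (LINT u|lborel. \<kappa> (a * u))"
    using i1 i0 by (subst Bochner_Integration.integral_diff) auto
  also have "\<dots> = (LINT u|lborel. \<kappa> (a * u) * J u / \<bar>D\<bar>)"
    by (simp add: mean_scaled[OF a])
  finally have e2: "(LINT z|lborel. pairing R a t c b t' c' z)
      = (LINT u|lborel. \<kappa> (a * u) * (J u - J 0) / \<bar>D\<bar>)"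
    using e1 by metis
  have rw: "(v - u - E) / D = - E / D + - u / D + v / D" for u v
    by (simp add: diff_divide_distrib)
  define M where "M = 16 * R\<^sup>2 * (1 / a / \<bar>D\<bar>) * (1 / b / \<bar>D\<bar>)"
  have M0: "0 \<le> M" unfolding M_def using a b by simp
  have Jb: "\<bar>J u - J 0\<bar> \<le> 2 * (1 / b) * (M * K)" if u: "\<bar>u\<bar> \<le> 1 / a" for u
  proof -
    \<comment> \<open>The term \<open>V 0 u - V 0 0\<close> does not depend on \<open>v\<close>, so
      it integrates to zero against the second profile. Subtracting it produces the mixed second
      difference, with increments \<open>- u / D\<close> and \<open>v / D\<close>.\<close>
    define W where "W v = (V v u - V v 0 - (V 0 u - V 0 0)) * \<kappa> (b * v)" for v
    have iV: "integrable lborel (\<lambda>v. V v u * \<kappa> (b * v))" for u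
      by (rule integrable_scaled[OF b contV])
    have ib: "integrable lborel (\<lambda>u. \<kappa> (b * u))"
      using integrable_scaled[OF b, of "\<lambda>_. 1"] by simp
    have "(LINT v|lborel. W v) = (LINT v|lborel. V v u * \<kappa> (b * v) - V v 0 * \<kappa> (b * v)
        - (V 0 u - V 0 0) * \<kappa> (b * v))"
      unfolding W_def by (intro Bochner_Integration.integral_cong) (auto simp: algebra_simps)
    also have "\<dots> = J u - J 0 - (V 0 u - V 0 0) * (LINT v|lborel. \<kappa> (b * v))"
      unfolding J_def using iV ib
      by (simp add: Bochner_Integration.integral_diff Bochner_Integration.integrable_diff)
    finally have "J u - J 0 = (LINT v|lborel. W v)" by (simp add: mean_scaled[OF b])
    also have "\<bar>\<dots>\<bar> \<le> 2 * (1 / b) * (M * K)"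
    proof (rule lborel_integral_abs_le_support[of _ _ 0])
      fix v assume "\<bar>v - 0\<bar> \<le> 1 / b"
      then have v: "\<bar>v\<bar> \<le> 1 / b" by simp
      have "\<bar>V v u - V v 0 - (V 0 u - V 0 0)\<bar> \<le> 16 * R\<^sup>2 * \<bar>- u / D\<bar> * \<bar>v / D\<bar>"
        using cutoff_mixed_difference[OF R, of "- E / D" "- u / D" "v / D"]
        unfolding V_def rw by (simp add: algebra_simps)
      also have "\<dots> \<le> M"
        unfolding M_def abs_divide abs_minus using u v
        by (intro mult_mono divide_right_mono) (use a in auto)
      finally have "\<bar>V v u - V v 0 - (V 0 u - V 0 0)\<bar> \<le> M" .
      then show "\<bar>W v\<bar> \<le> M * K"
        unfolding W_def abs_mult by (intro mult_mono bound) (auto simp: M0)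
    next
      fix v assume "\<bar>v - 0\<bar> > 1 / b"
      then show "W v = 0" unfolding W_def using supp_scaled[OF b] by simp
    qed (use M0 K_nonneg b in auto)
    finally show ?thesis .
  qed
  \<comment> \<open>The two supports contribute the lengths \<open>2 / a\<close> and
    \<open>2 / b\<close>, the bound \<open>M\<close> contributes \<open>1 / (a * b * D ^ 2)\<close>,
    and the Jacobian one more factor \<open>1 / \<bar>D\<bar>\<close>.\<close>
  have "\<bar>LINT u|lborel. \<kappa> (a * u) * (J u - J 0) / \<bar>D\<bar>\<bar>
      \<le> 2 * (1 / a) * (K * (2 * (1 / b) * (M * K)) / \<bar>D\<bar>)"
  proof (rule lborel_integral_abs_le_support[of _ _ 0])
    fix u assume "\<bar>u - 0\<bar> \<le> 1 / a"
    then have "\<bar>J u - J 0\<bar> \<le> 2 * (1 / b) * (M * K)" by (intro Jb) simp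
    then show "\<bar>\<kappa> (a * u) * (J u - J 0) / \<bar>D\<bar>\<bar> \<le> K * (2 * (1 / b) * (M * K)) / \<bar>D\<bar>"
      unfolding abs_divide abs_mult abs_abs
      by (intro divide_right_mono mult_mono bound) (auto simp: K_nonneg)
  next
    fix u assume "\<bar>u - 0\<bar> > 1 / a"
    then show "\<kappa> (a * u) * (J u - J 0) / \<bar>D\<bar> = 0" using supp_scaled[OF a] by simp
  qed (use M0 K_nonneg a b in auto)
  also have "\<dots> = 64 * R\<^sup>2 * K\<^sup>2 / (a\<^sup>2 * b\<^sup>2 * \<bar>D\<bar> ^ 3)"
    unfolding M_def using a b D by (simp add: field_simps power2_eq_square power3_eq_cube)
  finally show ?thesis using e2 unfolding D_def by simp
qed

end

text \<open>The induction carries the sharper bound \<open>4 - 2 / (n + 1)\<close> for the sum from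
  \<open>- n\<close> to \<open>n\<close>. It is preserved by telescoping, as
  \<open>1 / (n + 2) ^ 2\<close> is at most \<open>1 / (n + 1) - 1 / (n + 2)\<close>.\<close>

lemma sum_inverse_square_ints_le:
  assumes "finite M"
  shows "(\<Sum>m\<in>M. 1 / (1 + \<bar>real_of_int m\<bar>)\<^sup>2) \<le> 4"
proof -
  have b: "(\<Sum>m\<in>{- int n..int n}. 1 / (1 + \<bar>real_of_int m\<bar>)\<^sup>2) \<le> 4 - 2 / (real n + 1)" for n
  proof (induction n)
    case 0
    then show ?case by simp
  next
    case (Suc n)
    have s: "{- int (Suc n)..int (Suc n)} = insert (- int (Suc n)) (insert (int (Suc n)) {- int n..int n})"
      by auto
    have "(\<Sum>m\<in>{- int (Suc n)..int (Suc n)}. 1 / (1 + \<bar>real_of_int m\<bar>)\<^sup>2)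
        = 2 / (real n + 2)\<^sup>2 + (\<Sum>m\<in>{- int n..int n}. 1 / (1 + \<bar>real_of_int m\<bar>)\<^sup>2)"
      unfolding s by (subst sum.insert; simp)+
    also have "\<dots> \<le> 2 / (real n + 2)\<^sup>2 + (4 - 2 / (real n + 1))" using Suc by simp
    also have "\<dots> \<le> 4 - 2 / (real (Suc n) + 1)"
    proof -
      have "2 / (real n + 2)\<^sup>2 \<le> 2 / ((real n + 1) * (real n + 2))"
        by (intro divide_left_mono) (auto simp: power2_eq_square)
      also have "\<dots> = 2 / (real n + 1) - 2 / (real (Suc n) + 1)"
        by (simp add: field_simps)
      finally show ?thesis by simp
    qed
    finally show ?case .
  qed
  obtain n where n: "\<forall>m\<in>M. nat \<bar>m\<bar> \<le> n"
    using assms finite_nat_set_iff_bounded_le[of "(\<lambda>m. nat \<bar>m\<bar>) ` M"] by auto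
  have "M \<subseteq> {- int n..int n}" using n by force
  then have "(\<Sum>m\<in>M. 1 / (1 + \<bar>real_of_int m\<bar>)\<^sup>2) \<le> (\<Sum>m\<in>{- int n..int n}. 1 / (1 + \<bar>real_of_int m\<bar>)\<^sup>2)"
    by (intro sum_mono2) auto
  also have "\<dots> \<le> 4" using b[of n] by (smt (verit) divide_nonneg_nonneg of_nat_0_le_iff)
  finally show ?thesis .
qed

section \<open>Pointwise bounds by integrals over boxes\<close>

text \<open>The function \<open>(x - a - w) * (g x) ^ 2\<close> vanishes at \<open>a + w\<close> and
  equals \<open>- w * (g a) ^ 2\<close> at \<open>a\<close>. Hence the integral of its derivative is
  the left-hand side, and the cross term is split by the inequality of arithmetic and geometric
  means.\<close>

lemma sobolev_1d:
  fixes g g' :: "real \<Rightarrow> real"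
  assumes d: "\<And>x. (g has_real_derivative g' x) (at x)" and c: "continuous_on UNIV g'" and w: "0 < w"
  shows "w * (g a)\<^sup>2 \<le> (LINT x|lborel. indicator {a..a + w} x * (2 * (g x)\<^sup>2 + w\<^sup>2 * (g' x)\<^sup>2))"
proof -
  have cg: "continuous_on UNIV g" by (meson DERIV_continuous_on d has_field_derivative_at_within)
  let ?f = "\<lambda>x. 2 * (g x)\<^sup>2 + w\<^sup>2 * (g' x)\<^sup>2"
  have "((\<lambda>x. (g x)\<^sup>2 + 2 * (x - a - w) * g x * g' x) has_integral
      (a + w - a - w) * (g (a + w))\<^sup>2 - (a - a - w) * (g a)\<^sup>2) {a..a + w}"
  proof (rule fundamental_theorem_of_calculus)
    fix x
    have "((\<lambda>x. (x - a - w) * (g x)\<^sup>2) has_real_derivative (g x)\<^sup>2 + 2 * (x - a - w) * g x * g' x) (at x)"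
      by (auto intro!: derivative_eq_intros d)
    then show "((\<lambda>x. (x - a - w) * (g x)\<^sup>2) has_vector_derivative (g x)\<^sup>2 + 2 * (x - a - w) * g x * g' x)
        (at x within {a..a + w})"
      by (simp add: has_real_derivative_iff_has_vector_derivative has_vector_derivative_at_within)
  qed (use w in simp)
  then have h: "((\<lambda>x. (g x)\<^sup>2 + 2 * (x - a - w) * g x * g' x) has_integral w * (g a)\<^sup>2) {a..a + w}"
    by simp
  have si: "set_integrable lborel {a..a + w} ?f"
    by (rule borel_integrable_atLeastAtMost')
      (auto intro!: continuous_intros continuous_on_subset[OF c] continuous_on_subset[OF cg])
  have "w * (g a)\<^sup>2 \<le> integral {a..a + w} ?f"
  proof (rule has_integral_le[OF h])
    show "(?f has_integral integral {a..a + w} ?f) {a..a + w}"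
      using set_borel_integral_eq_integral(1)[OF si] by (rule integrable_integral)
    fix x assume x: "x \<in> {a..a + w}"
    have "2 * (x - a - w) * g x * g' x \<le> \<bar>2 * (x - a - w) * g x * g' x\<bar>" by simp
    also have "\<dots> = \<bar>x - a - w\<bar> * (2 * \<bar>g x\<bar> * \<bar>g' x\<bar>)"
      unfolding abs_mult by simp
    also have "\<dots> \<le> w * (2 * \<bar>g x\<bar> * \<bar>g' x\<bar>)" using x by (intro mult_right_mono) auto
    also have "\<dots> \<le> (g x)\<^sup>2 + w\<^sup>2 * (g' x)\<^sup>2"
      using zero_le_power2[of "\<bar>g x\<bar> - w * \<bar>g' x\<bar>"]
      by (simp add: power2_diff power_mult_distrib algebra_simps)
    finally show "(g x)\<^sup>2 + 2 * (x - a - w) * g x * g' x \<le> ?f x" by simp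
  qed
  then show ?thesis
    using set_borel_integral_eq_integral(2)[OF si] unfolding set_lebesgue_integral_def by simp
qed

text \<open>The one-dimensional inequality in \<open>x\<close> along the bottom edge of the box,
  followed by the same inequality in \<open>y\<close> for both \<open>G\<close> and
  \<open>Gx\<close>. The coefficients 4, 2, 2, 1 are the products of the one-dimensional
  coefficients 2 and 1.\<close>

lemma sobolev_2d:
  fixes G Gx Gy Gxy :: "real \<Rightarrow> real \<Rightarrow> real"
  assumes dx: "\<And>x y. ((\<lambda>x. G x y) has_real_derivative Gx x y) (at x)"
    and dy: "\<And>x y. (G x has_real_derivative Gy x y) (at y)"
    and dxy: "\<And>x y. (Gx x has_real_derivative Gxy x y) (at y)"
    and cont: "continuous_on UNIV (\<lambda>(x, y). G x y)" "continuous_on UNIV (\<lambda>(x, y). Gx x y)"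
      "continuous_on UNIV (\<lambda>(x, y). Gy x y)" "continuous_on UNIV (\<lambda>(x, y). Gxy x y)"
    and w: "0 < w"
  shows "w\<^sup>2 * (G a b)\<^sup>2 \<le> (LINT z|lborel. indicator ({a..a + w} \<times> {b..b + w}) z *
    (4 * (G (fst z) (snd z))\<^sup>2 + 2 * (w * Gx (fst z) (snd z))\<^sup>2 + 2 * (w * Gy (fst z) (snd z))\<^sup>2
      + (w\<^sup>2 * Gxy (fst z) (snd z))\<^sup>2))"
proof -
  have c2: "continuous_on S (\<lambda>s. F (p s) (q s))"
    if "continuous_on UNIV (\<lambda>(x, y). F x y)" "continuous_on S p" "continuous_on S q"
    for F :: "real \<Rightarrow> real \<Rightarrow> real" and p q and S :: "'c::topological_space set"
    using continuous_on_compose2[OF that(1), of S "\<lambda>s. (p s, q s)"] that(2,3)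
    by (auto intro!: continuous_intros)
  define E where "E z = 4 * (G (fst z) (snd z))\<^sup>2 + 2 * (w * Gx (fst z) (snd z))\<^sup>2
    + 2 * (w * Gy (fst z) (snd z))\<^sup>2 + (w\<^sup>2 * Gxy (fst z) (snd z))\<^sup>2" for z :: plane
  \<comment> \<open>The integrand that the inequality in \<open>x\<close> leaves on the edge
    \<open>y = b\<close>.\<close>
  define H where "H x = 2 * (G x b)\<^sup>2 + w\<^sup>2 * (Gx x b)\<^sup>2" for x
  have cE: "continuous_on S E" for S
    unfolding E_def by (intro continuous_intros c2[OF cont(1)] c2[OF cont(2)] c2[OF cont(3)] c2[OF cont(4)])
  have ind: "integrable lborel (\<lambda>x. indicator {u..u + w} x * f x)" if "continuous_on UNIV f" for u and f :: "real \<Rightarrow> real"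
    using borel_integrable_compact[of "{u..u + w}" f] continuous_on_subset[OF that] by simp
  have iE: "integrable lborel (\<lambda>z. indicator ({a..a + w} \<times> {b..b + w}) z * E z)"
    using borel_integrable_compact[of "{a..a + w} \<times> {b..b + w}" E] cE by (simp add: compact_Times)
  have 1: "w * (G a b)\<^sup>2 \<le> (LINT x|lborel. indicator {a..a + w} x * H x)"
    unfolding H_def by (rule sobolev_1d[OF dx _ w]) (intro c2[OF cont(2)] continuous_intros)
  have 2: "w * H x \<le> (LINT y|lborel. indicator {b..b + w} y * E (x, y))" for x
  proof -
    have "w * (G x b)\<^sup>2 \<le> (LINT y|lborel. indicator {b..b + w} y * (2 * (G x y)\<^sup>2 + w\<^sup>2 * (Gy x y)\<^sup>2))"
      by (rule sobolev_1d[OF dy _ w]) (intro c2[OF cont(3)] continuous_intros)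
    moreover have "w * (Gx x b)\<^sup>2 \<le> (LINT y|lborel. indicator {b..b + w} y * (2 * (Gx x y)\<^sup>2 + w\<^sup>2 * (Gxy x y)\<^sup>2))"
      by (rule sobolev_1d[OF dxy _ w]) (intro c2[OF cont(4)] continuous_intros)
    ultimately have "2 * (w * (G x b)\<^sup>2) + w\<^sup>2 * (w * (Gx x b)\<^sup>2)
      \<le> 2 * (LINT y|lborel. indicator {b..b + w} y * (2 * (G x y)\<^sup>2 + w\<^sup>2 * (Gy x y)\<^sup>2))
        + w\<^sup>2 * (LINT y|lborel. indicator {b..b + w} y * (2 * (Gx x y)\<^sup>2 + w\<^sup>2 * (Gxy x y)\<^sup>2))"
      by (intro add_mono mult_left_mono) auto
    also have "\<dots> = (LINT y|lborel. 2 * (indicator {b..b + w} y * (2 * (G x y)\<^sup>2 + w\<^sup>2 * (Gy x y)\<^sup>2))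
        + w\<^sup>2 * (indicator {b..b + w} y * (2 * (Gx x y)\<^sup>2 + w\<^sup>2 * (Gxy x y)\<^sup>2)))"
    proof -
      have "continuous_on UNIV (\<lambda>y. 2 * (G x y)\<^sup>2 + w\<^sup>2 * (Gy x y)\<^sup>2)"
        by (intro continuous_intros c2[OF cont(1)] c2[OF cont(3)])
      moreover have "continuous_on UNIV (\<lambda>y. 2 * (Gx x y)\<^sup>2 + w\<^sup>2 * (Gxy x y)\<^sup>2)"
        by (intro continuous_intros c2[OF cont(2)] c2[OF cont(4)])
      ultimately show ?thesis
        by (subst Bochner_Integration.integral_add)
          (simp_all only: integrable_mult_right ind Bochner_Integration.integral_mult_right_zero)
    qed
    also have "\<dots> = (LINT y|lborel. indicator {b..b + w} y * E (x, y))"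
      unfolding E_def by (intro Bochner_Integration.integral_cong)
        (auto simp: algebra_simps power_mult_distrib indicator_def)
    finally show ?thesis unfolding H_def by (simp add: algebra_simps)
  qed
  have "w\<^sup>2 * (G a b)\<^sup>2 = w * (w * (G a b)\<^sup>2)" by (simp add: power2_eq_square)
  also have "\<dots> \<le> w * (LINT x|lborel. indicator {a..a + w} x * H x)"
    using 1 w by (intro mult_left_mono) auto
  also have "\<dots> = (LINT x|lborel. w * (indicator {a..a + w} x * H x))" by simp
  also have "\<dots> \<le> (LINT x|lborel. LINT y|lborel. indicator ({a..a + w} \<times> {b..b + w}) (x, y) * E (x, y))"
  proof (rule integral_mono)
    show "integrable lborel (\<lambda>x. w * (indicator {a..a + w} x * H x))"
      unfolding H_def by (intro integrable_mult_right ind continuous_intros c2[OF cont(1)] c2[OF cont(2)])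
    show "integrable lborel (\<lambda>x. LINT y|lborel. indicator ({a..a + w} \<times> {b..b + w}) (x, y) * E (x, y))"
      by (rule lborel_integral_iterated(3)[OF iE])
    fix x
    have "(LINT y|lborel. indicator ({a..a + w} \<times> {b..b + w}) (x, y) * E (x, y))
        = indicator {a..a + w} x * (LINT y|lborel. indicator {b..b + w} y * E (x, y))"
      by (simp add: indicator_times mult.assoc)
    then show "w * (indicator {a..a + w} x * H x)
        \<le> (LINT y|lborel. indicator ({a..a + w} \<times> {b..b + w}) (x, y) * E (x, y))"
      using 2[of x] by (simp add: indicator_def)
  qed
  also have "\<dots> = (LINT z|lborel. indicator ({a..a + w} \<times> {b..b + w}) z * E z)"
    by (rule lborel_integral_iterated(1)[OF iE, symmetric])
  finally show ?thesis unfolding E_def .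
qed

section \<open>The weighted energy of a sum of waves\<close>

context mean_zero_profile
begin

text \<open>The factor in 343 is the decay constant of a single pairing. The factor
  \<open>12 * (R + 22)\<close> is \<open>3 * (R + 22)\<close>, for the number of intercept cells per
  slope cell, times 4 for the sum of inverse squares.\<close>

definition energy_const :: "real \<Rightarrow> real" where
  "energy_const R = 12 * (R + 22) * (343 * (8 * R ^ 5 * K\<^sup>2 + 1024 * R\<^sup>2 * K\<^sup>2))"

text \<open>The coefficients \<open>\<alpha>\<close> make rescaled partial derivatives of such sums
  again of this form: the chain rule only produces factors depending on the line.\<close>

definition wave_sum :: "'i set \<Rightarrow> ('i \<Rightarrow> real) \<Rightarrow> ('i \<Rightarrow> real) \<Rightarrow> ('i \<Rightarrow> real) \<Rightarrow> ('i \<Rightarrow> real) \<Rightarrow> plane \<Rightarrow> real" where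
  "wave_sum I \<alpha> A t c z = (\<Sum>i\<in>I. \<alpha> i * \<kappa> (A i * (snd z - t i * fst z - c i)))"

lemma continuous_on_wave_sum: "continuous_on S (wave_sum I \<alpha> A t c)"
  unfolding wave_sum_def by (intro continuous_intros)

lemma cutoff_wave_sum_squared:
  "cutoff R (fst z) * (wave_sum I \<alpha> A t c z)\<^sup>2
    = (\<Sum>i\<in>I. \<Sum>j\<in>I. \<alpha> i * \<alpha> j * pairing R (A i) (t i) (c i) (A j) (t j) (c j) z)"
  unfolding wave_sum_def power2_eq_square sum_product sum_distrib_left pairing_def
  by (simp only: sum_distrib_left mult_ac)

lemma integrable_cutoff_wave_sum_squared:
  assumes "0 \<le> R" "\<And>i. i \<in> I \<Longrightarrow> 0 < A i"
  shows "integrable lborel (\<lambda>z. cutoff R (fst z) * (wave_sum I \<alpha> A t c z)\<^sup>2)"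
  unfolding cutoff_wave_sum_squared
  using assms by (intro Bochner_Integration.integrable_sum integrable_mult_right integrable_pairing) auto

text \<open>Both pairing bounds are merged into one with cubic decay in the index of the slope cell
  of width \<open>w / 5\<close>. With \<open>D = \<bar>t - t'\<bar>\<close> the index is at most
  \<open>5 D / w + 1\<close> in absolute value. So \<open>1 + \<bar>index\<bar>\<close> is at most 7
  if \<open>D < w\<close>, and at most \<open>7 D / w\<close> otherwise; 343 is the cube of 7. The
  two constants absorb \<open>1 / a \<le> 2 w\<close> and \<open>1 / b \<le> 2 w\<close>.\<close>

lemma pairing_integral_le_cell:
  assumes w: "0 < w" and R: "0 \<le> R" and a: "1 / (2 * w) \<le> a" and b: "1 / (2 * w) \<le> b"
  shows "\<bar>LINT z|lborel. pairing R a t c b t' c' z\<bar>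
    \<le> 343 * (8 * R ^ 5 * K\<^sup>2 + 1024 * R\<^sup>2 * K\<^sup>2) * w / (1 + \<bar>real_of_int \<lfloor>(t' - t) / (w / 5)\<rfloor>\<bar>) ^ 3"
    (is "?X \<le> 343 * (?B1 + ?B2) * w / (1 + ?m) ^ 3")
proof -
  have a0: "0 < a" and b0: "0 < b" using w a b by (smt (verit) divide_pos_pos)+
  have ia: "1 / a \<le> 2 * w" "1 / b \<le> 2 * w" using w a b a0 b0 by (simp_all add: field_simps)
  have B: "0 \<le> ?B1" "0 \<le> ?B2" using R by auto
  have fl: "?m \<le> 5 * \<bar>t - t'\<bar> / w + 1"
  proof -
    have "?m \<le> \<bar>(t' - t) / (w / 5)\<bar> + 1" by linarith
    also have "\<bar>(t' - t) / (w / 5)\<bar> = 5 * \<bar>t - t'\<bar> / w"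
      using w unfolding abs_divide abs_minus_commute[of t' t] by simp
    finally show ?thesis .
  qed
  have b1: "?X \<le> ?B1 * w"
  proof -
    have "?X \<le> 4 * R ^ 5 * K\<^sup>2 * (1 / a)" using pairing_integral_le[OF a0 b0 R] by simp
    also have "\<dots> \<le> 4 * R ^ 5 * K\<^sup>2 * (2 * w)" using ia R by (intro mult_left_mono) auto
    finally show ?thesis by simp
  qed
  show ?thesis
  proof (cases "\<bar>t - t'\<bar> < w")
    case True
    then have "5 * \<bar>t - t'\<bar> / w \<le> 5" using w by (simp add: field_simps)
    then have "1 + ?m \<le> 7" using fl by linarith
    then have "(1 + ?m) ^ 3 \<le> 7 ^ 3" by (intro power_mono) auto
    then have m: "1 \<le> 343 / (1 + ?m) ^ 3" by (subst le_divide_eq_1_pos) auto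
    have "?X \<le> (?B1 + ?B2) * w" using b1 B w by (simp add: distrib_right add_increasing2)
    also have "\<dots> \<le> (?B1 + ?B2) * w * (343 / (1 + ?m) ^ 3)"
      using mult_left_mono[OF m, of "(?B1 + ?B2) * w"] B w by simp
    finally show ?thesis by (simp add: mult_ac)
  next
    case False
    then have D: "w \<le> \<bar>t - t'\<bar>" by simp
    then have t: "t \<noteq> t'" "0 < \<bar>t - t'\<bar>" using w by auto
    have "1 + ?m \<le> 7 * \<bar>t - t'\<bar> / w" using fl D w by (simp add: field_simps)
    then have "(1 + ?m) ^ 3 \<le> (7 * \<bar>t - t'\<bar> / w) ^ 3" by (intro power_mono) auto
    also have "\<dots> = 343 * (\<bar>t - t'\<bar> ^ 3 / w ^ 3)" by (simp add: power_divide power_mult_distrib)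
    finally have "w ^ 3 / \<bar>t - t'\<bar> ^ 3 \<le> 343 / (1 + ?m) ^ 3"
      using t w by (simp add: field_simps add_pos_nonneg)
    then have m: "w ^ 4 / \<bar>t - t'\<bar> ^ 3 \<le> w * (343 / (1 + ?m) ^ 3)"
      using mult_left_mono[of _ _ w] w by (fastforce simp: eval_nat_numeral)
    have "?X \<le> 64 * R\<^sup>2 * K\<^sup>2 / (a\<^sup>2 * b\<^sup>2 * \<bar>t - t'\<bar> ^ 3)"
      by (rule pairing_integral_le_transversal[OF a0 b0 R t(1)])
    also have "\<dots> = 64 * R\<^sup>2 * K\<^sup>2 / \<bar>t - t'\<bar> ^ 3 * ((1 / a)\<^sup>2 * (1 / b)\<^sup>2)"
      by (simp add: power_divide)
    also have "\<dots> \<le> 64 * R\<^sup>2 * K\<^sup>2 / \<bar>t - t'\<bar> ^ 3 * ((2 * w)\<^sup>2 * (2 * w)\<^sup>2)"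
      using ia a0 b0 by (intro mult_left_mono mult_mono power_mono) auto
    also have "\<dots> = ?B2 * (w ^ 4 / \<bar>t - t'\<bar> ^ 3)"
      by (simp add: eval_nat_numeral)
    also have "\<dots> \<le> (?B1 + ?B2) * (w * (343 / (1 + ?m) ^ 3))"
      using m B w by (intro mult_mono) auto
    finally show ?thesis by (simp add: mult_ac)
  qed
qed

text \<open>Cut the plane of slopes and intercepts into cells of side \<open>w / 5\<close> relative
  to line \<open>i\<close>. A nonzero pairing forces the intercept index to be
  \<open>O(1 + \<bar>a\<bar>)\<close>, where \<open>a\<close> is the slope index. Each cell holds at
  most \<open>m\<close> lines, each contributing \<open>O(w / (1 + \<bar>a\<bar>) ^ 3)\<close>.
  Summing over intercept cells costs one power, and the series of
  \<open>1 / (1 + \<bar>a\<bar>) ^ 2\<close> remains.\<close>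

lemma pairing_row_sum_le:
  fixes t c A :: "'i \<Rightarrow> real"
  assumes I: "finite I" and w: "0 < w" and R: "0 \<le> R" and A: "\<And>i. i \<in> I \<Longrightarrow> 1 / (2 * w) \<le> A i"
    and cnt: "\<And>t0 c0. card {i \<in> I. t0 \<le> t i \<and> t i < t0 + w / 5 \<and> c0 \<le> c i \<and> c i < c0 + w / 5} \<le> m"
    and i: "i \<in> I"
  shows "(\<Sum>j\<in>I. \<bar>LINT z|lborel. pairing R (A i) (t i) (c i) (A j) (t j) (c j) z\<bar>)
    \<le> energy_const R * w * real m"
proof -
  define X where "X j = \<bar>LINT z|lborel. pairing R (A i) (t i) (c i) (A j) (t j) (c j) z\<bar>" for j
  define B where "B = 343 * (8 * R ^ 5 * K\<^sup>2 + 1024 * R\<^sup>2 * K\<^sup>2)"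
  have B: "0 \<le> B" unfolding B_def using R by auto
  define q where "q j = (\<lfloor>(t j - t i) / (w / 5)\<rfloor>, \<lfloor>(c j - c i) / (w / 5)\<rfloor>)" for j
  define J where "J = {j \<in> I. X j \<noteq> 0}"
  \<comment> \<open>The half-widths add up to at most \<open>4 w\<close>, which is 20 cell sides;
    rounding the intercept to a cell index adds 1.\<close>
  define N where "N = \<lceil>R\<rceil> + 21"
  define f where "f p = real m * (B * w / (1 + \<bar>real_of_int (fst p)\<bar>) ^ 3)" for p :: "int \<times> int"
  have f0: "0 \<le> f p" for p unfolding f_def using B w by simp
  have J: "finite J" "J \<subseteq> I" unfolding J_def using I by auto
  have N: "1 \<le> real_of_int N" "real_of_int N \<le> R + 22" "R + 21 \<le> real_of_int N"
    unfolding N_def using R by linarith+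
  have Apos: "0 < A j" if "j \<in> I" for j using A[OF that] w by (smt (verit) divide_pos_pos)
  have row: "\<bar>snd (q j)\<bar> \<le> N * (1 + \<bar>fst (q j)\<bar>)" if j: "j \<in> J" for j
  proof -
    have jI: "j \<in> I" using j J by auto
    have "1 / A i \<le> 2 * w" "1 / A j \<le> 2 * w"
      using A[OF i] A[OF jI] w Apos[OF i] Apos[OF jI] by (simp_all add: field_simps)
    moreover have "\<not> \<bar>c i - c j\<bar> > R * \<bar>t i - t j\<bar> + 1 / A i + 1 / A j"
      using pairing_integral_eq_0[OF Apos[OF i] Apos[OF jI] R] j unfolding J_def X_def by fastforce
    ultimately have "\<bar>c j - c i\<bar> \<le> R * \<bar>t j - t i\<bar> + 4 * w" by (simp add: abs_minus_commute)
    then have "\<bar>c j - c i\<bar> * (5 / w) \<le> (R * \<bar>t j - t i\<bar> + 4 * w) * (5 / w)"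
      using w by (intro mult_right_mono) auto
    then have 1: "\<bar>(c j - c i) / (w / 5)\<bar> \<le> R * \<bar>(t j - t i) / (w / 5)\<bar> + 20"
      using w unfolding abs_divide by (simp add: distrib_right add_divide_distrib mult_ac)
    let ?a = "real_of_int \<bar>fst (q j)\<bar>"
    have "\<bar>(t j - t i) / (w / 5)\<bar> \<le> ?a + 1" unfolding q_def fst_conv by linarith
    then have "R * \<bar>(t j - t i) / (w / 5)\<bar> \<le> R * (?a + 1)" using R by (intro mult_left_mono)
    moreover have "real_of_int \<bar>snd (q j)\<bar> \<le> \<bar>(c j - c i) / (w / 5)\<bar> + 1" unfolding q_def snd_conv by linarith
    ultimately have "real_of_int \<bar>snd (q j)\<bar> \<le> R * (?a + 1) + 21 * 1" using 1 by linarith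
    also have "\<dots> \<le> R * (?a + 1) + 21 * (?a + 1)" by simp
    also have "\<dots> = (R + 21) * (?a + 1)" by (simp add: algebra_simps)
    also have "\<dots> \<le> real_of_int N * (?a + 1)" using N by (intro mult_right_mono) auto
    also have "\<dots> = real_of_int (N * (1 + \<bar>fst (q j)\<bar>))" by (simp add: algebra_simps)
    finally show ?thesis by linarith
  qed
  have cell: "(\<Sum>j\<in>{j \<in> J. q j = p}. X j) \<le> f p" for p
  proof -
    define t0 c0 where "t0 = t i + real_of_int (fst p) * (w / 5)" and "c0 = c i + real_of_int (snd p) * (w / 5)"
    have "(\<Sum>j\<in>{j \<in> J. q j = p}. X j) \<le> of_nat (card {j \<in> J. q j = p}) * (B * w / (1 + \<bar>real_of_int (fst p)\<bar>) ^ 3)"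
    proof (rule sum_bounded_above)
      fix j assume j: "j \<in> {j \<in> J. q j = p}"
      then have "j \<in> I" "fst p = \<lfloor>(t j - t i) / (w / 5)\<rfloor>" using J unfolding q_def by auto
      then show "X j \<le> B * w / (1 + \<bar>real_of_int (fst p)\<bar>) ^ 3"
        using pairing_integral_le_cell[OF w R A[OF i] A] unfolding X_def B_def by metis
    qed
    also have "\<dots> \<le> f p"
    proof -
      have "{j \<in> J. q j = p} \<subseteq> {j \<in> I. t0 \<le> t j \<and> t j < t0 + w / 5 \<and> c0 \<le> c j \<and> c j < c0 + w / 5}"
      proof
        fix j assume j: "j \<in> {j \<in> J. q j = p}"
        have "real_of_int (fst p) \<le> (t j - t i) / (w / 5)" "(t j - t i) / (w / 5) < real_of_int (fst p) + 1"
          "real_of_int (snd p) \<le> (c j - c i) / (w / 5)" "(c j - c i) / (w / 5) < real_of_int (snd p) + 1"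
          using j unfolding q_def by auto
        then show "j \<in> {j \<in> I. t0 \<le> t j \<and> t j < t0 + w / 5 \<and> c0 \<le> c j \<and> c j < c0 + w / 5}"
          using j J w unfolding t0_def c0_def by (auto simp: field_simps)
      qed
      then have "card {j \<in> J. q j = p}
          \<le> card {j \<in> I. t0 \<le> t j \<and> t j < t0 + w / 5 \<and> c0 \<le> c j \<and> c j < c0 + w / 5}"
        using I by (intro card_mono) auto
      also have "\<dots> \<le> m" by (rule cnt)
      finally have "card {j \<in> J. q j = p} \<le> m" .
      then show ?thesis unfolding f_def using B w by (intro mult_right_mono) auto
    qed
    finally show ?thesis .
  qed
  define M where "M = fst ` q ` J"
  have M: "finite M" unfolding M_def using J by auto
  have "(\<Sum>j\<in>I. X j) = (\<Sum>j\<in>J. X j)"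
    by (rule sum.mono_neutral_right) (use I in \<open>auto simp: J_def\<close>)
  also have "\<dots> = (\<Sum>p\<in>q ` J. \<Sum>j\<in>{j \<in> J. q j = p}. X j)"
    by (rule sum.image_gen[OF J(1)])
  also have "\<dots> \<le> (\<Sum>p\<in>q ` J. f p)" by (intro sum_mono cell)
  \<comment> \<open>From the occupied cells to all cells allowed by \<open>row\<close>; the added
    terms are nonnegative.\<close>
  also have "\<dots> \<le> (\<Sum>p\<in>Sigma M (\<lambda>a. {- (N * (1 + \<bar>a\<bar>))..N * (1 + \<bar>a\<bar>)}). f p)"
  proof (rule sum_mono2)
    show "q ` J \<subseteq> Sigma M (\<lambda>a. {- (N * (1 + \<bar>a\<bar>))..N * (1 + \<bar>a\<bar>)})"
    proof
      fix p assume "p \<in> q ` J"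
      then obtain j where j: "j \<in> J" "p = q j" by auto
      have "fst p \<in> M" unfolding M_def using j by auto
      moreover have "snd p \<in> {- (N * (1 + \<bar>fst p\<bar>))..N * (1 + \<bar>fst p\<bar>)}" using row[OF j(1)] j(2) by (auto simp: abs_le_iff)
      ultimately show "p \<in> Sigma M (\<lambda>a. {- (N * (1 + \<bar>a\<bar>))..N * (1 + \<bar>a\<bar>)})" by (cases p) auto
    qed
  qed (use M f0 in auto)
  also have "\<dots> = (\<Sum>a\<in>M. \<Sum>b\<in>{- (N * (1 + \<bar>a\<bar>))..N * (1 + \<bar>a\<bar>)}. f (a, b))"
    using M by (subst sum.Sigma) auto
  also have "\<dots> \<le> (\<Sum>a\<in>M. 3 * (R + 22) * (real m * (B * w)) * (1 / (1 + \<bar>real_of_int a\<bar>)\<^sup>2))"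
  proof (rule sum_mono)
    fix a assume "a \<in> M"
    let ?s = "1 + \<bar>real_of_int a\<bar>"
    have s: "1 \<le> ?s" by simp
    have n0: "0 \<le> N * (1 + \<bar>a\<bar>)" using N by (intro mult_nonneg_nonneg) auto
    have "real (card {- (N * (1 + \<bar>a\<bar>))..N * (1 + \<bar>a\<bar>)}) = 2 * (real_of_int N * ?s) + 1"
      using n0 by simp
    \<comment> \<open>The index interval has \<open>2 * N * ?s + 1\<close> elements, and
      \<open>N * ?s\<close> is at least 1.\<close>
    also have "\<dots> \<le> 3 * (real_of_int N * ?s)" using mult_mono[of 1 "real_of_int N" 1 ?s] N s by simp
    also have "\<dots> \<le> 3 * ((R + 22) * ?s)" using N by (intro mult_left_mono mult_right_mono) auto
    finally have cd: "real (card {- (N * (1 + \<bar>a\<bar>))..N * (1 + \<bar>a\<bar>)}) \<le> 3 * ((R + 22) * ?s)" .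
    have "(\<Sum>b\<in>{- (N * (1 + \<bar>a\<bar>))..N * (1 + \<bar>a\<bar>)}. f (a, b))
        = real (card {- (N * (1 + \<bar>a\<bar>))..N * (1 + \<bar>a\<bar>)}) * f (a, 0)"
      unfolding f_def by simp
    also have "\<dots> \<le> 3 * ((R + 22) * ?s) * f (a, 0)" by (intro mult_right_mono cd f0)
    also have "\<dots> = 3 * (R + 22) * (real m * (B * w)) * (?s / ?s ^ 3)" unfolding f_def by simp
    also have "?s / ?s ^ 3 = 1 / ?s\<^sup>2"
    proof -
      have "r / r ^ 3 = 1 / r\<^sup>2" for r :: real by (simp add: power2_eq_square power3_eq_cube)
      then show ?thesis .
    qed
    finally show "(\<Sum>b\<in>{- (N * (1 + \<bar>a\<bar>))..N * (1 + \<bar>a\<bar>)}. f (a, b))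
        \<le> 3 * (R + 22) * (real m * (B * w)) * (1 / ?s\<^sup>2)" .
  qed
  also have "\<dots> = 3 * (R + 22) * (real m * (B * w)) * (\<Sum>a\<in>M. 1 / (1 + \<bar>real_of_int a\<bar>)\<^sup>2)"
    by (simp add: sum_distrib_left)
  also have "\<dots> \<le> 3 * (R + 22) * (real m * (B * w)) * 4"
    using B w R by (intro mult_left_mono sum_inverse_square_ints_le M) auto
  also have "\<dots> = energy_const R * w * real m" unfolding energy_const_def B_def by simp
  finally show ?thesis unfolding X_def .
qed

text \<open>Expanding the square gives a double sum of pairings. With coefficients at most 1 in
  absolute value, it is bounded by the number of rows times the bound on a row sum.\<close>

lemma energy_le:
  fixes t c A \<alpha> :: "'i \<Rightarrow> real"
  assumes I: "finite I" and w: "0 < w" and R: "0 \<le> R" and A: "\<And>i. i \<in> I \<Longrightarrow> 1 / (2 * w) \<le> A i"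
    and \<alpha>: "\<And>i. i \<in> I \<Longrightarrow> \<bar>\<alpha> i\<bar> \<le> 1"
    and cnt: "\<And>t0 c0. card {i \<in> I. t0 \<le> t i \<and> t i < t0 + w / 5 \<and> c0 \<le> c i \<and> c i < c0 + w / 5} \<le> m"
  shows "(LINT z|lborel. cutoff R (fst z) * (wave_sum I \<alpha> A t c z)\<^sup>2)
    \<le> energy_const R * w * real m * real (card I)"
proof -
  have Apos: "0 < A j" if "j \<in> I" for j using A[OF that] w by (smt (verit) divide_pos_pos)
  let ?X = "\<lambda>i j. LINT z|lborel. pairing R (A i) (t i) (c i) (A j) (t j) (c j) z"
  have "(LINT z|lborel. cutoff R (fst z) * (wave_sum I \<alpha> A t c z)\<^sup>2) = (\<Sum>i\<in>I. \<Sum>j\<in>I. \<alpha> i * \<alpha> j * ?X i j)"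
    unfolding cutoff_wave_sum_squared
    by (simp add: Bochner_Integration.integral_sum integrable_pairing Apos R)
  also have "\<dots> \<le> (\<Sum>i\<in>I. \<Sum>j\<in>I. \<bar>?X i j\<bar>)"
  proof (intro sum_mono)
    fix i j assume ij: "i \<in> I" "j \<in> I"
    have "\<alpha> i * \<alpha> j * ?X i j \<le> \<bar>\<alpha> i * \<alpha> j * ?X i j\<bar>" by simp
    also have "\<dots> = \<bar>\<alpha> i\<bar> * \<bar>\<alpha> j\<bar> * \<bar>?X i j\<bar>" by (simp add: abs_mult)
    also have "\<dots> \<le> 1 * 1 * \<bar>?X i j\<bar>" using \<alpha> ij by (intro mult_right_mono mult_mono) auto
    finally show "\<alpha> i * \<alpha> j * ?X i j \<le> \<bar>?X i j\<bar>" by simp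
  qed
  also have "\<dots> \<le> (\<Sum>i\<in>I. energy_const R * w * real m)"
    by (intro sum_mono pairing_row_sum_le[OF I w R A cnt])
  also have "\<dots> = energy_const R * w * real m * real (card I)" by simp
  finally show ?thesis .
qed

end

section \<open>From the energy bound to sums over points and lines\<close>

text \<open>The Sobolev inequality at each point bounds \<open>G ^ 2\<close> by the energy of four
  wave sums in a box. Summing over the points counts each place at most \<open>mP\<close> times, so
  the global energy bound applies, and the Cauchy-Schwarz inequality passes from the sum of squares
  to the sum itself.\<close>

lemma smoothed_incidence_sum_le:
  fixes k k' k'' :: "real \<Rightarrow> real" and xs ys :: "'p \<Rightarrow> real" and t c :: "'i \<Rightarrow> real"
  assumes p0: "mean_zero_profile k K" and p1: "mean_zero_profile k' K" and p2: "mean_zero_profile k'' K"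
    and d1: "\<And>u. (k has_real_derivative k' u) (at u)"
    and d2: "\<And>u. (k' has_real_derivative k'' u) (at u)"
    and w: "0 < w" "w \<le> W" and P: "finite P" and I: "finite I"
    and t1: "\<And>i. i \<in> I \<Longrightarrow> \<bar>t i\<bar> \<le> 1"
    and xs: "\<And>p. p \<in> P \<Longrightarrow> 0 \<le> xs p \<and> xs p \<le> 1"
    and cntP: "\<And>x y. card {p \<in> P. x \<le> xs p \<and> xs p \<le> x + w \<and> y \<le> ys p \<and> ys p \<le> y + w} \<le> mP"
    and cntL: "\<And>t0 c0. card {i \<in> I. t0 \<le> t i \<and> t i < t0 + w / 5 \<and> c0 \<le> c i \<and> c i < c0 + w / 5} \<le> mL"
  shows "\<bar>\<Sum>p\<in>P. \<Sum>i\<in>I. k ((ys p - t i * xs p - c i) / (w * sqrt (1 + (t i)\<^sup>2)))\<bar>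
    \<le> 3 * sqrt (mean_zero_profile.energy_const K (2 * (1 + W))) * sqrt (real (card P) * real (card I) * real mP * real mL / w)"
proof -
  interpret p0: mean_zero_profile k K by (rule p0)
  interpret p1: mean_zero_profile k' K by (rule p1)
  interpret p2: mean_zero_profile k'' K by (rule p2)
  \<comment> \<open>The boxes at points with first coordinate in \<open>{0..1}\<close> lie over
    \<open>{0..1 + W}\<close>, that is within \<open>R / 2\<close>, where the weight is at least 1.
    Through \<open>R\<close> the constant depends on \<open>W\<close>.\<close>
  define R where "R = 2 * (1 + W)"
  have R: "2 \<le> R" "0 \<le> R" using w unfolding R_def by auto
  \<comment> \<open>Multiplying the vertical offset by \<open>A i\<close> gives the signed distance
    to the line divided by \<open>w\<close>. Slopes of size at most 1 keep \<open>A i\<close>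
    between \<open>1 / (2 * w)\<close> and \<open>1 / w\<close>.\<close>
  define A where "A i = 1 / (w * sqrt (1 + (t i)\<^sup>2))" for i
  have sq: "1 \<le> sqrt (1 + (t i)\<^sup>2)" for i by simp
  have A: "1 / (2 * w) \<le> A i" if "i \<in> I" for i
  proof -
    have "(t i)\<^sup>2 \<le> 1" using t1[OF that] abs_le_square_iff[of "t i" 1] by simp
    then have "sqrt (1 + (t i)\<^sup>2) \<le> sqrt (2\<^sup>2)" by (intro real_sqrt_le_mono) simp
    then have "w * sqrt (1 + (t i)\<^sup>2) \<le> 2 * w" using w by simp
    then show ?thesis unfolding A_def using w sq[of i]
      by (intro divide_left_mono) (auto intro!: mult_pos_pos simp: add_pos_nonneg)
  qed
  have Aw: "0 < A i * w" "A i * w \<le> 1" for i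
    unfolding A_def using w sq[of i] by (auto simp: field_simps add_pos_nonneg)
  have Apos: "0 < A i" for i using Aw(1)[of i] w by (simp add: zero_less_mult_iff)
  \<comment> \<open>The chain rule factors of the derivatives in \<open>x\<close>, in
    \<open>y\<close> and in both, made scale-free by \<open>w\<close>, \<open>w\<close> and
    \<open>w ^ 2\<close>.\<close>
  define \<alpha>1 where "\<alpha>1 i = - t i * (A i * w)" for i
  define \<alpha>2 where "\<alpha>2 i = A i * w" for i
  define \<alpha>3 where "\<alpha>3 i = - t i * (A i * w)\<^sup>2" for i
  have \<alpha>: "\<bar>\<alpha>1 i\<bar> \<le> 1" "\<bar>\<alpha>2 i\<bar> \<le> 1" "\<bar>\<alpha>3 i\<bar> \<le> 1" if "i \<in> I" for i
  proof -
    have "\<bar>t i\<bar> * (A i * w) \<le> 1 * 1" using t1[OF that] Aw[of i] by (intro mult_mono) auto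
    then show "\<bar>\<alpha>1 i\<bar> \<le> 1" unfolding \<alpha>1_def abs_mult[of _ "A i * w"] using Aw[of i] by simp
    show "\<bar>\<alpha>2 i\<bar> \<le> 1" unfolding \<alpha>2_def using Aw[of i] by simp
    have "\<bar>t i\<bar> * (A i * w)\<^sup>2 \<le> 1 * 1\<^sup>2"
      using t1[OF that] Aw[of i] by (intro mult_mono power_mono) auto
    then show "\<bar>\<alpha>3 i\<bar> \<le> 1" unfolding \<alpha>3_def by (simp add: abs_mult)
  qed
  define s where "s i x y = A i * (y - t i * x - c i)" for i x y
  define G where "G x y = (\<Sum>i\<in>I. k (s i x y))" for x y
  define Gx where "Gx x y = (\<Sum>i\<in>I. - t i * A i * k' (s i x y))" for x y
  define Gy where "Gy x y = (\<Sum>i\<in>I. A i * k' (s i x y))" for x y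
  define Gxy where "Gxy x y = (\<Sum>i\<in>I. - t i * (A i)\<^sup>2 * k'' (s i x y))" for x y
  define W0 where "W0 = p0.wave_sum I (\<lambda>_. 1) A t c"
  define W1 where "W1 = p1.wave_sum I \<alpha>1 A t c"
  define W2 where "W2 = p1.wave_sum I \<alpha>2 A t c"
  define W3 where "W3 = p2.wave_sum I \<alpha>3 A t c"
  define E where "E z = 4 * (W0 z)\<^sup>2 + 2 * (W1 z)\<^sup>2 + 2 * (W2 z)\<^sup>2 + (W3 z)\<^sup>2" for z
  define box where "box p = {xs p..xs p + w} \<times> {ys p..ys p + w}" for p
  have eqs: "G x y = W0 (x, y)" "w * Gx x y = W1 (x, y)" "w * Gy x y = W2 (x, y)" "w\<^sup>2 * Gxy x y = W3 (x, y)" for x y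
    unfolding G_def Gx_def Gy_def Gxy_def W0_def W1_def W2_def W3_def s_def \<alpha>1_def \<alpha>2_def \<alpha>3_def
      p0.wave_sum_def p1.wave_sum_def p2.wave_sum_def sum_distrib_left
    by (auto intro!: sum.cong simp: power_mult_distrib)
  have sx: "((\<lambda>x. s i x y) has_real_derivative - t i * A i) (at x)" for i x y
    unfolding s_def by (auto intro!: derivative_eq_intros)
  have sy: "((\<lambda>y. s i x y) has_real_derivative A i) (at y)" for i x y
    unfolding s_def by (auto intro!: derivative_eq_intros)
  have E0: "0 \<le> E z" for z unfolding E_def by simp
  have pt: "w\<^sup>2 * (G (xs p) (ys p))\<^sup>2 \<le> (LINT z|lborel. indicator (box p) z * E z)" for p
  proof -
    have "w\<^sup>2 * (G (xs p) (ys p))\<^sup>2 \<le> (LINT z|lborel. indicator (box p) z *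
      (4 * (G (fst z) (snd z))\<^sup>2 + 2 * (w * Gx (fst z) (snd z))\<^sup>2 + 2 * (w * Gy (fst z) (snd z))\<^sup>2
        + (w\<^sup>2 * Gxy (fst z) (snd z))\<^sup>2))"
      unfolding box_def
    proof (rule sobolev_2d[OF _ _ _ _ _ _ _ w(1)])
      fix x y
      show "((\<lambda>x. G x y) has_real_derivative Gx x y) (at x)"
        unfolding G_def Gx_def
        by (intro DERIV_sum) (use DERIV_chain2[OF d1 sx] in \<open>simp add: mult_ac\<close>)
      show "(G x has_real_derivative Gy x y) (at y)"
        unfolding G_def Gy_def
        by (intro DERIV_sum) (use DERIV_chain2[OF d1 sy] in \<open>simp add: mult_ac\<close>)
      show "(Gx x has_real_derivative Gxy x y) (at y)"
        unfolding Gx_def Gxy_def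
      proof (intro DERIV_sum)
        fix i
        have "((\<lambda>y. - t i * A i * k' (s i x y)) has_real_derivative - t i * A i * (k'' (s i x y) * A i)) (at y)"
          by (intro DERIV_cmult DERIV_chain2[OF d2 sy])
        then show "((\<lambda>y. - t i * A i * k' (s i x y)) has_real_derivative - t i * (A i)\<^sup>2 * k'' (s i x y)) (at y)"
          by (simp add: power2_eq_square mult_ac)
      qed
    qed (auto simp: G_def Gx_def Gy_def Gxy_def s_def case_prod_unfold
        intro!: continuous_intros p0.cont_comp p1.cont_comp p2.cont_comp)
    then show ?thesis unfolding eqs E_def by simp
  qed
  have cE: "continuous_on S E" for S
    unfolding E_def W0_def W1_def W2_def W3_def
    by (intro continuous_intros p0.continuous_on_wave_sum p1.continuous_on_wave_sum p2.continuous_on_wave_sum)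
  have iE: "integrable lborel (\<lambda>z. indicator (box p) z * E z)" for p
    using borel_integrable_compact[of "box p" E] cE unfolding box_def by (simp add: compact_Times)
  have iW: "integrable lborel (\<lambda>z. cutoff R (fst z) * (W0 z)\<^sup>2)" "integrable lborel (\<lambda>z. cutoff R (fst z) * (W1 z)\<^sup>2)"
    "integrable lborel (\<lambda>z. cutoff R (fst z) * (W2 z)\<^sup>2)" "integrable lborel (\<lambda>z. cutoff R (fst z) * (W3 z)\<^sup>2)"
    unfolding W0_def W1_def W2_def W3_def
    by (intro p0.integrable_cutoff_wave_sum_squared p1.integrable_cutoff_wave_sum_squared
        p2.integrable_cutoff_wave_sum_squared R Apos)+
  have VE: "cutoff R (fst z) * E z = 4 * (cutoff R (fst z) * (W0 z)\<^sup>2) + 2 * (cutoff R (fst z) * (W1 z)\<^sup>2)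
    + 2 * (cutoff R (fst z) * (W2 z)\<^sup>2) + cutoff R (fst z) * (W3 z)\<^sup>2" for z
    unfolding E_def by (simp add: algebra_simps)
  have iVE: "integrable lborel (\<lambda>z. cutoff R (fst z) * E z)"
    unfolding VE by (intro Bochner_Integration.integrable_add integrable_mult_right iW)
  define Y where "Y = p0.energy_const R * w * real mL * real (card I)"
  have "(LINT z|lborel. cutoff R (fst z) * E z) = 4 * (LINT z|lborel. cutoff R (fst z) * (W0 z)\<^sup>2)
      + 2 * (LINT z|lborel. cutoff R (fst z) * (W1 z)\<^sup>2) + 2 * (LINT z|lborel. cutoff R (fst z) * (W2 z)\<^sup>2)
      + (LINT z|lborel. cutoff R (fst z) * (W3 z)\<^sup>2)"
    unfolding VE using iW by simp
  \<comment> \<open>All four energies obey the same bound \<open>Y\<close>, so the Sobolev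
    coefficients add up to 9.\<close>
  also have "\<dots> \<le> 4 * Y + 2 * Y + 2 * Y + Y"
    unfolding Y_def W0_def W1_def W2_def W3_def
    by (intro add_mono mult_left_mono p0.energy_le[OF I w(1) R(2) A _ cntL]
        p1.energy_le[OF I w(1) R(2) A _ cntL] p2.energy_le[OF I w(1) R(2) A _ cntL]) (auto simp: \<alpha>)
  finally have eb: "(LINT z|lborel. cutoff R (fst z) * E z) \<le> 9 * Y" by simp
  have "w\<^sup>2 * (\<Sum>p\<in>P. (G (xs p) (ys p))\<^sup>2) \<le> (\<Sum>p\<in>P. LINT z|lborel. indicator (box p) z * E z)"
    unfolding sum_distrib_left by (intro sum_mono pt)
  also have "\<dots> = (LINT z|lborel. (\<Sum>p\<in>P. indicator (box p) z * E z))"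
    by (rule Bochner_Integration.integral_sum[symmetric]) (rule iE)
  also have "\<dots> \<le> (LINT z|lborel. real mP * (cutoff R (fst z) * E z))"
  proof (rule integral_mono)
    show "integrable lborel (\<lambda>z. \<Sum>p\<in>P. indicator (box p) z * E z)"
      by (intro Bochner_Integration.integrable_sum iE)
    show "integrable lborel (\<lambda>z. real mP * (cutoff R (fst z) * E z))"
      by (intro integrable_mult_right iVE)
    fix z :: plane
    \<comment> \<open>A box contains \<open>z\<close> exactly when its corner point lies in the
      reflected box, with upper right corner \<open>z\<close>. The bound is written as
      \<open>fst z - w + w\<close> to match \<open>cntP\<close>.\<close>
    let ?Q = "{p \<in> P. fst z - w \<le> xs p \<and> xs p \<le> fst z - w + w \<and> snd z - w \<le> ys p \<and> ys p \<le> snd z - w + w}"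
    have box: "z \<in> box p \<longleftrightarrow> fst z - w \<le> xs p \<and> xs p \<le> fst z - w + w \<and> snd z - w \<le> ys p \<and> ys p \<le> snd z - w + w" for p
      unfolding box_def by (cases z) auto
    have "(\<Sum>p\<in>P. indicator (box p) z * E z) = (\<Sum>p\<in>?Q. E z)"
      by (subst sum.inter_filter[OF P]) (auto intro!: sum.cong simp: indicator_def box)
    then have e: "(\<Sum>p\<in>P. indicator (box p) z * E z) = real (card ?Q) * E z" by simp
    show "(\<Sum>p\<in>P. indicator (box p) z * E z) \<le> real mP * (cutoff R (fst z) * E z)"
    proof (cases "?Q = {}")
      case True
      then have "card ?Q = 0" by (simp only: card.empty)
      then show ?thesis unfolding e using E0[of z] cutoff_nonneg[of R "fst z"] by (simp only: mult_zero_left of_nat_0) simp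
    next
      case False
      then obtain p where p: "p \<in> P" "fst z - w \<le> xs p" "xs p \<le> fst z" by auto
      then have "\<bar>fst z\<bar> \<le> R / 2" using xs[OF p(1)] w unfolding R_def by auto
      then have V1: "1 \<le> cutoff R (fst z)" by (rule cutoff_ge_1[OF R(1)])
      have "real (card ?Q) * E z \<le> real mP * (1 * E z)"
        using cntP[of "fst z - w" "snd z - w"] E0[of z] by (simp add: mult_right_mono)
      also have "\<dots> \<le> real mP * (cutoff R (fst z) * E z)"
        using V1 E0[of z] by (intro mult_left_mono mult_right_mono) auto
      finally show ?thesis unfolding e .
    qed
  qed
  also have "\<dots> \<le> real mP * (9 * Y)" using eb by (simp add: mult_left_mono)
  finally have S: "w\<^sup>2 * (\<Sum>p\<in>P. (G (xs p) (ys p))\<^sup>2) \<le> real mP * (9 * Y)" .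
  have "(\<Sum>p\<in>P. (G (xs p) (ys p))\<^sup>2) \<le> real mP * (9 * Y) / w\<^sup>2"
    using S w by (simp add: pos_le_divide_eq mult.commute)
  also have "\<dots> = 9 * p0.energy_const R * real mP * real mL * real (card I) / w"
    unfolding Y_def using w by (simp add: power2_eq_square field_simps)
  finally have S': "(\<Sum>p\<in>P. (G (xs p) (ys p))\<^sup>2) \<le> 9 * p0.energy_const R * real mP * real mL * real (card I) / w" .
  \<comment> \<open>Cauchy-Schwarz over the points; the square root of 9 is the factor 3 of the
    conclusion.\<close>
  have "(\<Sum>p\<in>P. G (xs p) (ys p))\<^sup>2 \<le> (\<Sum>p\<in>P. (G (xs p) (ys p))\<^sup>2) * real (card P)"
    by (rule sum_squared_le_sum_of_squares)
  also have "\<dots> \<le> 9 * p0.energy_const R * real mP * real mL * real (card I) / w * real (card P)"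
    by (intro mult_right_mono S') auto
  also have "\<dots> = 9 * (p0.energy_const R * (real (card P) * real (card I) * real mP * real mL / w))" by simp
  finally have "sqrt ((\<Sum>p\<in>P. G (xs p) (ys p))\<^sup>2)
      \<le> sqrt (9 * (p0.energy_const R * (real (card P) * real (card I) * real mP * real mL / w)))"
    by (rule real_sqrt_le_mono)
  also have "\<dots> = sqrt 9 * (sqrt (p0.energy_const R) * sqrt (real (card P) * real (card I) * real mP * real mL / w))"
    by (simp only: real_sqrt_mult)
  also have "sqrt 9 = 3" by (rule real_sqrt_unique) auto
  finally have "\<bar>\<Sum>p\<in>P. G (xs p) (ys p)\<bar>
      \<le> 3 * sqrt (p0.energy_const R) * sqrt (real (card P) * real (card I) * real mP * real mL / w)" by simp
  moreover have "G (xs p) (ys p) = (\<Sum>i\<in>I. k ((ys p - t i * xs p - c i) / (w * sqrt (1 + (t i)\<^sup>2))))" for p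
    unfolding G_def s_def A_def by simp
  ultimately show ?thesis unfolding R_def by simp
qed

section \<open>Lines as graphs\<close>

text \<open>The two orders of the coordinates, so that graphs over either axis are treated by a
  single argument.\<close>

definition coordinate_pair :: "(plane \<Rightarrow> real) \<Rightarrow> (plane \<Rightarrow> real) \<Rightarrow> bool" where
  "coordinate_pair u v \<longleftrightarrow> (u = fst \<and> v = snd) \<or> (u = snd \<and> v = fst)"

lemma dist_coordinate_pair:
  "coordinate_pair u v \<Longrightarrow> dist p q = sqrt ((u p - u q)\<^sup>2 + (v p - v q)\<^sup>2)"
  unfolding coordinate_pair_def by (cases p; cases q) (auto simp: dist_Pair_Pair dist_real_def add.commute)

lemma coordinate_pair_obtain:
  assumes "coordinate_pair u v"
  obtains q where "u q = a" "v q = b"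
  using assms unfolding coordinate_pair_def by (metis fst_conv snd_conv)

lemma infdist_graph:
  assumes uv: "coordinate_pair u v"
  shows "infdist p {q. v q = t * u q + c} = \<bar>v p - t * u p - c\<bar> / sqrt (1 + t\<^sup>2)"
proof -
  let ?l = "{q. v q = t * u q + c}"
  let ?h = "v p - t * u p - c"
  have pos: "0 < 1 + t\<^sup>2" by (simp add: add_pos_nonneg)
  \<comment> \<open>The point \<open>q\<close> below is the foot of the perpendicular:
    \<open>p\<close> moved by \<open>r\<close> along the normal direction with coordinates
    \<open>t\<close> and \<open>-1\<close>.\<close>
  define r where "r = ?h / (1 + t\<^sup>2)"
  obtain q where q: "u q = u p + t * r" "v q = v p - r" using coordinate_pair_obtain[OF uv] by metis
  have "r * (1 + t\<^sup>2) = ?h" unfolding r_def using pos by simp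
  then have ql: "q \<in> ?l" using q by (simp add: algebra_simps power2_eq_square)
  have "dist p q = sqrt (r\<^sup>2 * (1 + t\<^sup>2))"
    unfolding dist_coordinate_pair[OF uv] q by (simp add: algebra_simps power_mult_distrib)
  also have "\<dots> = \<bar>?h\<bar> / (1 + t\<^sup>2) * sqrt (1 + t\<^sup>2)"
    unfolding r_def using pos by (simp add: real_sqrt_mult abs_divide)
  also have "\<dots> = \<bar>?h\<bar> / sqrt (1 + t\<^sup>2)"
    using real_div_sqrt[of "1 + t\<^sup>2"] pos by (simp add: divide_simps flip: power2_eq_square)
  finally have dq: "dist p q = \<bar>?h\<bar> / sqrt (1 + t\<^sup>2)" .
  have ge: "\<bar>?h\<bar> / sqrt (1 + t\<^sup>2) \<le> dist p q'" if "q' \<in> ?l" for q'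
  proof -
    define a b where "a = u p - u q'" and "b = v p - v q'"
    have h: "?h = b - t * a" using that unfolding a_def b_def by (simp add: algebra_simps)
    \<comment> \<open>Cauchy-Schwarz; the difference of the two sides is the square of
      \<open>a + t * b\<close>.\<close>
    have "(b - t * a)\<^sup>2 \<le> (1 + t\<^sup>2) * (a\<^sup>2 + b\<^sup>2)"
      using zero_le_power2[of "a + t * b"] by (simp add: algebra_simps power2_eq_square)
    then have "sqrt ((b - t * a)\<^sup>2) \<le> sqrt ((1 + t\<^sup>2) * (a\<^sup>2 + b\<^sup>2))" by (rule real_sqrt_le_mono)
    then have "\<bar>b - t * a\<bar> \<le> sqrt (1 + t\<^sup>2) * sqrt (a\<^sup>2 + b\<^sup>2)" by (simp add: real_sqrt_mult)
    then show ?thesis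
      unfolding h dist_coordinate_pair[OF uv] a_def[symmetric] b_def[symmetric]
      using pos by (simp add: divide_le_eq mult.commute)
  qed
  have ne: "?l \<noteq> {}" using ql by blast
  have "\<bar>?h\<bar> / sqrt (1 + t\<^sup>2) \<le> infdist p ?l"
    unfolding infdist_notempty[OF ne] by (rule cINF_greatest[OF ne ge])
  moreover have "infdist p ?l \<le> \<bar>?h\<bar> / sqrt (1 + t\<^sup>2)" using infdist_le[OF ql, of p] dq by simp
  ultimately show ?thesis by simp
qed

lemma is_line_graph:
  assumes uv: "coordinate_pair u v"
  shows "is_line {q. v q = t * u q + c}"
proof -
  obtain a b where ab: "u a = 0" "v a = c" "u b = 1" "v b = t + c"
    using coordinate_pair_obtain[OF uv] by metis
  have "{q. v q = t * u q + c} = range (\<lambda>s. a + s *\<^sub>R (b - a))"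
  proof (intro set_eqI iffI)
    fix q assume "q \<in> {q. v q = t * u q + c}"
    then have "q = a + u q *\<^sub>R (b - a)"
      using ab uv unfolding coordinate_pair_def
      by (cases q; cases a; cases b) (auto simp: algebra_simps)
    then show "q \<in> range (\<lambda>s. a + s *\<^sub>R (b - a))" by blast
  next
    fix q assume "q \<in> range (\<lambda>s. a + s *\<^sub>R (b - a))"
    then show "q \<in> {q. v q = t * u q + c}"
      using ab uv unfolding coordinate_pair_def by (auto simp: algebra_simps)
  qed
  then have "{q. v q = t * u q + c} = affine hull {a, b}" by (simp add: affine_hull_2_alt)
  moreover have "a \<noteq> b" using ab by auto
  ultimately show ?thesis unfolding is_line_def by (simp add: aff_dim_2 aff_dim_affine_hull)
qed

text \<open>The line is the affine hull of two of its points. It is written over the coordinate in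
  which their difference is larger in absolute value, which makes the slope at most 1.\<close>

lemma is_line_imp_graph:
  assumes "is_line l"
  obtains (fst) t c where "\<bar>t\<bar> \<le> 1" "l = {q. snd q = t * fst q + c}"
    | (snd) t c where "\<bar>t\<bar> \<le> 1" "l = {q. fst q = t * snd q + c}"
proof -
  have l: "affine l" "aff_dim l = 1" using assms unfolding is_line_def by auto
  have "l \<noteq> {}" using l(2) by auto
  then obtain a where a: "a \<in> l" by auto
  have "l \<noteq> {a}" using l(2) by auto
  then obtain b where b: "b \<in> l" "b \<noteq> a" using a by auto
  have "affine hull {a, b} \<subseteq> l" using l a b by (intro hull_minimal) auto
  then have "affine hull {a, b} = l"
    by (intro affine_dim_equal) (use l b in auto)
  then have leq: "l = range (\<lambda>s. a + s *\<^sub>R (b - a))" by (simp add: affine_hull_2_alt)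
  define X Y where "X = fst b - fst a" and "Y = snd b - snd a"
  have mem: "q \<in> l \<longleftrightarrow> (\<exists>s. fst q = fst a + s * X \<and> snd q = snd a + s * Y)" for q
    unfolding leq X_def Y_def by (auto simp: prod_eq_iff)
  have XY: "X \<noteq> 0 \<or> Y \<noteq> 0" using b(2) unfolding X_def Y_def by (auto simp: prod_eq_iff)
  show thesis
  proof (cases "\<bar>Y\<bar> \<le> \<bar>X\<bar>")
    case True
    then have X: "X \<noteq> 0" using XY by auto
    show thesis
    proof (rule fst)
      show "\<bar>Y / X\<bar> \<le> 1" using True X by simp
      show "l = {q. snd q = Y / X * fst q + (snd a - Y / X * fst a)}"
      proof (intro set_eqI)
        fix q
        have "snd q = Y / X * fst q + (snd a - Y / X * fst a)
          \<longleftrightarrow> (\<exists>s. fst q = fst a + s * X \<and> snd q = snd a + s * Y)" (is "?L \<longleftrightarrow> ?R")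
        proof
          assume ?L
          then show ?R using X by (intro exI[of _ "(fst q - fst a) / X"]) (simp add: field_simps)
        qed (use X in \<open>auto simp: field_simps\<close>)
        then show "q \<in> l \<longleftrightarrow> q \<in> {q. snd q = Y / X * fst q + (snd a - Y / X * fst a)}"
          using mem by simp
      qed
    qed
  next
    case False
    then have Y: "Y \<noteq> 0" by auto
    show thesis
    proof (rule snd)
      show "\<bar>X / Y\<bar> \<le> 1" using False Y by simp
      show "l = {q. fst q = X / Y * snd q + (fst a - X / Y * snd a)}"
      proof (intro set_eqI)
        fix q
        have "fst q = X / Y * snd q + (fst a - X / Y * snd a)
          \<longleftrightarrow> (\<exists>s. fst q = fst a + s * X \<and> snd q = snd a + s * Y)" (is "?L \<longleftrightarrow> ?R")
        proof
          assume ?L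
          then show ?R using Y by (intro exI[of _ "(snd q - snd a) / Y"]) (simp add: field_simps)
        qed (use Y in \<open>auto simp: field_simps\<close>)
        then show "q \<in> l \<longleftrightarrow> q \<in> {q. fst q = X / Y * snd q + (fst a - X / Y * snd a)}"
          using mem by simp
      qed
    qed
  qed
qed

section \<open>Counting points in boxes and lines in parameter cells\<close>

text \<open>Infinitely many squares yield only finitely many counts, as each is at most
  \<open>card P\<close>; hence \<open>Max\<close> is a genuine upper bound. The same holds for tubes
  below.\<close>

lemma card_le_max_points:
  assumes "finite P" "is_square w Q"
  shows "card (P \<inter> Q) \<le> max_points P w"
  unfolding max_points_def
proof (rule Max_ge)
  have "{card (P \<inter> Q) |Q. is_square w Q} \<subseteq> {..card P}" using assms(1) by (auto intro!: card_mono)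
  then show "finite {card (P \<inter> Q) |Q. is_square w Q}" by (rule finite_subset) simp
qed (use assms(2) in auto)

lemma card_le_max_lines:
  assumes "finite L" "is_tube w T"
  shows "card {l \<in> L. l \<inter> unit_square \<subseteq> T} \<le> max_lines L w"
  unfolding max_lines_def
proof (rule Max_ge)
  have "{card {l \<in> L. l \<inter> unit_square \<subseteq> T} |T. is_tube w T} \<subseteq> {..card L}"
    using assms(1) by (auto intro!: card_mono)
  then show "finite {card {l \<in> L. l \<inter> unit_square \<subseteq> T} |T. is_tube w T}" by (rule finite_subset) simp
qed (use assms(2) in auto)

lemma card_points_in_box_le:
  assumes "finite P" and uv: "coordinate_pair u v"
  shows "card {p \<in> P. x \<le> u p \<and> u p \<le> x + w \<and> y \<le> v p \<and> v p \<le> y + w} \<le> max_points P w"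
proof -
  let ?Q = "{p. x \<le> u p \<and> u p \<le> x + w \<and> y \<le> v p \<and> v p \<le> y + w}"
  obtain a where a: "u a = x" "v a = y" using coordinate_pair_obtain[OF uv] by metis
  obtain d where d: "u d = 1" "v d = 0" using coordinate_pair_obtain[OF uv] by metis
  obtain e where e: "u e = 0" "v e = 1" using coordinate_pair_obtain[OF uv] by metis
  have "?Q = {a + s *\<^sub>R d + t *\<^sub>R e | s t. s \<in> {0..w} \<and> t \<in> {0..w}}"
  proof (intro set_eqI iffI)
    fix q assume q: "q \<in> ?Q"
    have "q = a + (u q - x) *\<^sub>R d + (v q - y) *\<^sub>R e"
      using a d e uv unfolding coordinate_pair_def by (auto simp: prod_eq_iff)
    moreover have "u q - x \<in> {0..w}" "v q - y \<in> {0..w}" using q by auto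
    ultimately show "q \<in> {a + s *\<^sub>R d + t *\<^sub>R e | s t. s \<in> {0..w} \<and> t \<in> {0..w}}" by blast
  next
    fix q assume "q \<in> {a + s *\<^sub>R d + t *\<^sub>R e | s t. s \<in> {0..w} \<and> t \<in> {0..w}}"
    then show "q \<in> ?Q" using a d e uv unfolding coordinate_pair_def by auto
  qed
  moreover have "norm d = 1" "norm e = 1" "d \<bullet> e = 0"
    using d e uv unfolding coordinate_pair_def by (auto simp: norm_prod_def inner_prod_def)
  ultimately have "is_square w ?Q" 
    unfolding is_square_def by (intro exI[of _ a] exI[of _ d] exI[of _ e] conjI)
  then have "card (P \<inter> ?Q) \<le> max_points P w" by (rule card_le_max_points[OF assms(1)])
  then show ?thesis by (simp add: Int_def)
qed

text \<open>Over \<open>{0..1}\<close> a line of the cell stays within \<open>2 * w / 5\<close> of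
  the line at the corner \<open>(t0, c0)\<close>, measured along the axis of \<open>v\<close>. The
  distance to that line is no larger and \<open>2 / 5 < 1 / 2\<close>, so the part in the unit
  square lies in the tube of width \<open>w\<close>. Hence the side \<open>w / 5\<close>.\<close>

lemma card_graphs_in_cell_le:
  assumes L: "finite L" and I: "I \<subseteq> L" and uv: "coordinate_pair u v" and w: "0 < w"
    and eq: "\<And>l. l \<in> I \<Longrightarrow> l = {q. v q = t l * u q + c l}"
  shows "card {l \<in> I. t0 \<le> t l \<and> t l < t0 + w / 5 \<and> c0 \<le> c l \<and> c l < c0 + w / 5} \<le> max_lines L w"
proof -
  let ?m = "{q. v q = t0 * u q + c0}"
  let ?T = "{x. infdist x ?m < w / 2}"
  have T: "is_tube w ?T" unfolding is_tube_def using is_line_graph[OF uv] by blast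
  have "{l \<in> I. t0 \<le> t l \<and> t l < t0 + w / 5 \<and> c0 \<le> c l \<and> c l < c0 + w / 5} \<subseteq> {l \<in> L. l \<inter> unit_square \<subseteq> ?T}"
  proof safe
    fix l q assume l: "l \<in> I" "t0 \<le> t l" "t l < t0 + w / 5" "c0 \<le> c l" "c l < c0 + w / 5"
      and q: "q \<in> l" "q \<in> unit_square"
    have u: "0 \<le> u q" "u q \<le> 1" using q(2) uv unfolding unit_square_def coordinate_pair_def by auto
    have "q \<in> {q. v q = t l * u q + c l}" using q(1) eq[OF l(1)] by blast
    then have h: "v q - t0 * u q - c0 = (t l - t0) * u q + (c l - c0)" by (simp add: algebra_simps)
    have "0 \<le> (t l - t0) * u q" using l u by (intro mult_nonneg_nonneg) auto
    moreover have "(t l - t0) * u q \<le> w / 5 * 1" using l u w by (intro mult_mono) auto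
    ultimately have "\<bar>v q - t0 * u q - c0\<bar> / 1 < w / 2" unfolding div_by_1 h using l w by linarith
    moreover have "\<bar>v q - t0 * u q - c0\<bar> / sqrt (1 + t0\<^sup>2) \<le> \<bar>v q - t0 * u q - c0\<bar> / 1"
      by (intro divide_left_mono) (auto simp: add_pos_nonneg)
    ultimately show "infdist q ?m < w / 2"
      unfolding infdist_graph[OF uv] by (rule le_less_trans[rotated])
  qed (use I in auto)
  then have "card {l \<in> I. t0 \<le> t l \<and> t l < t0 + w / 5 \<and> c0 \<le> c l \<and> c l < c0 + w / 5}
      \<le> card {l \<in> L. l \<inter> unit_square \<subseteq> ?T}"
    using L by (intro card_mono) auto
  also have "\<dots> \<le> max_lines L w" by (rule card_le_max_lines[OF L T])
  finally show ?thesis .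
qed

section \<open>The profile of the smoothed incidences\<close>

lemma frechet_derivative_first_coordinate:
  fixes f :: "plane \<Rightarrow> real"
  assumes "f differentiable (at (x, y))"
  shows "((\<lambda>s. f (s, y)) has_real_derivative frechet_derivative f (at (x, y)) (1, 0)) (at x)"
proof -
  have f: "(f has_derivative frechet_derivative f (at (x, y))) (at (x, y))"
    using assms by (simp add: frechet_derivative_works)
  have g: "((\<lambda>s. (s, y)) has_derivative (\<lambda>h. (h, 0))) (at x)"
    by (auto intro!: derivative_eq_intros)
  have "((\<lambda>s. f (s, y)) has_derivative (\<lambda>h. frechet_derivative f (at (x, y)) (h, 0))) (at x)"
    using has_derivative_compose[OF g, of f] f by simp
  moreover have "(\<lambda>h. frechet_derivative f (at (x, y)) (h, 0)) = (*) (frechet_derivative f (at (x, y)) (1, 0))"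
  proof
    fix h
    have "frechet_derivative f (at (x, y)) (h *\<^sub>R (1, 0)) = h *\<^sub>R frechet_derivative f (at (x, y)) (1, 0)"
      by (rule linear_cmul[OF has_derivative_linear[OF f]])
    then show "frechet_derivative f (at (x, y)) (h, 0) = frechet_derivative f (at (x, y)) (1, 0) * h"
      by simp
  qed
  ultimately show ?thesis unfolding has_field_derivative_def by metis
qed

text \<open>Compact support turns the Lebesgue integral into an integral over a fixed box, where the
  rules for integrals with a parameter give continuity and derivatives.\<close>

lemma lborel_integral_eq_integral_cbox:
  fixes f :: "'a::euclidean_space \<Rightarrow> real"
  assumes c: "continuous_on UNIV f" and s: "\<And>x. x \<notin> cbox a b \<Longrightarrow> f x = 0"
  shows "(LINT x|lborel. f x) = integral (cbox a b) f"
proof -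
  have si: "set_integrable lborel (cbox a b) f"
    unfolding set_integrable_def
    by (rule borel_integrable_compact) (auto intro: continuous_on_subset[OF c])
  have "(LINT x|lborel. f x) = (LINT x:cbox a b|lborel. f x)"
    unfolding set_lebesgue_integral_def
    by (intro Bochner_Integration.integral_cong refl) (auto simp: indicator_def s)
  also have "\<dots> = integral (cbox a b) f"
    using set_borel_integral_eq_integral(2)[OF si] .
  finally show ?thesis .
qed

lemma lborel_integral_uminus:
  fixes f :: "real \<Rightarrow> real"
  shows "(LINT x|lborel. f (- x)) = (LINT x|lborel. f x)"
  using lborel_integral_affine_image[of "-1" f 0] by simp

lemma lborel_integral_uminus_plane:
  fixes f :: "plane \<Rightarrow> real"
  assumes "continuous_on UNIV f" "compact S" "\<And>x. x \<notin> S \<Longrightarrow> f x = 0"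
  shows "(LINT z|lborel. f (- z)) = (LINT z|lborel. f z)"
proof -
  have i: "integrable lborel f" by (rule integrable_continuous_compact_support[OF assms])
  have i': "integrable lborel (\<lambda>z. f (- z))"
  proof (rule integrable_continuous_compact_support)
    show "continuous_on UNIV (\<lambda>z. f (- z))"
      by (rule continuous_on_compose2[OF assms(1)]) (auto intro!: continuous_intros)
    show "compact (uminus ` S)" by (rule compact_negations[OF assms(2)])
    fix z assume "z \<notin> uminus ` S"
    then have "- z \<notin> S" by (metis add.inverse_inverse imageI)
    then show "f (- z) = 0" by (rule assms(3))
  qed
  have "(LINT z|lborel. f (- z)) = (LINT x|lborel. LINT y|lborel. f (- x, - y))"
    using lborel_integral_iterated(1)[OF i'] by simp
  also have "\<dots> = (LINT x|lborel. LINT y|lborel. f (- x, y))"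
    using lborel_integral_uminus[of "\<lambda>y. f (- x, y)" for x] by simp
  also have "\<dots> = (LINT x|lborel. LINT y|lborel. f (x, y))"
    by (rule lborel_integral_uminus[of "\<lambda>x. LINT y|lborel. f (x, y)"])
  also have "\<dots> = (LINT z|lborel. f z)" by (rule lborel_integral_iterated(1)[OF i, symmetric])
  finally show ?thesis .
qed

text \<open>\<open>eta\<close> integrates the marginal \<open>b\<close> of the convolution
  \<open>f\<close> over a window of length 1. One derivative of the rescaled bump makes
  \<open>b\<close> continuously differentiable, and the window integral gains the second: its
  derivative is \<open>b (t + 1 / 2) - b (t - 1 / 2)\<close>. Evenness comes from the radial
  symmetry of the bump.\<close>

lemma eta_C2:
  assumes "radial_bump \<phi>"
  obtains \<eta>1 \<eta>2 where
    "\<And>x. (eta \<phi> has_real_derivative \<eta>1 x) (at x)"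
    "\<And>x. (\<eta>1 has_real_derivative \<eta>2 x) (at x)"
    "continuous_on UNIV \<eta>2"
    "\<And>x. \<bar>x\<bar> > 1 \<Longrightarrow> eta \<phi> x = 0"
    "\<And>x. eta \<phi> (- x) = eta \<phi> x"
proof -
  have sm: "continuously_differentiable 0 \<phi>" "continuously_differentiable (Suc 0) \<phi>"
    and rad: "\<And>x y. norm x = norm y \<Longrightarrow> \<phi> x = \<phi> y"
    and sup: "closure {x. \<phi> x \<noteq> 0} \<subseteq> ball 0 (1 / 50)"
    using assms unfolding radial_bump_def smooth_def by blast+
  have c\<phi>: "continuous_on UNIV \<phi>" using sm(1) by simp
  have d\<phi>: "\<phi> differentiable (at x)" for x using sm(2) by (cases x) (simp add: differentiable_on_def)
  have c\<phi>': "continuous_on UNIV (\<lambda>x. frechet_derivative \<phi> (at x) (1, 0))" using sm(2) by simp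
  have s\<phi>: "\<phi> x = 0" if "norm x \<ge> 1 / 50" for x
  proof (rule ccontr)
    assume "\<phi> x \<noteq> 0"
    then have "x \<in> ball 0 (1 / 50)" using sup closure_subset[of "{x. \<phi> x \<noteq> 0}"] by blast
    then show False using that by simp
  qed
  have even\<phi>: "\<phi> (- x) = \<phi> x" for x by (rule rad) simp
  define \<psi> where "\<psi> = rescale \<phi> (1 / 10)"
  have \<psi>: "\<psi> x = 100 * \<phi> (10 *\<^sub>R x)" for x
    unfolding \<psi>_def rescale_def by (simp add: power_int_minus power2_eq_square)
  \<comment> \<open>The partial derivative of \<open>\<psi>\<close> in the first coordinate: 100
    from the rescaling and 10 from the chain rule.\<close>
  define \<psi>1 where "\<psi>1 x = 1000 * frechet_derivative \<phi> (at (10 *\<^sub>R x)) (1, 0)" for x :: plane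
  have c\<psi>: "continuous_on UNIV \<psi>" unfolding \<psi>
    by (intro continuous_intros continuous_on_compose2[OF c\<phi>]) auto
  have c\<psi>1: "continuous_on UNIV \<psi>1" unfolding \<psi>1_def
    by (intro continuous_intros continuous_on_compose2[OF c\<phi>']) auto
  have d\<psi>: "((\<lambda>s. \<psi> (s, y)) has_real_derivative \<psi>1 (x, y)) (at x)" for x y
  proof -
    have "((\<lambda>s. \<phi> (s, 10 * y)) has_real_derivative frechet_derivative \<phi> (at (10 * x, 10 * y)) (1, 0)) (at (10 * x))"
      by (rule frechet_derivative_first_coordinate[OF d\<phi>])
    moreover have "((\<lambda>s. 10 * s) has_real_derivative 10) (at x)" by (auto intro!: derivative_eq_intros)
    ultimately have "((\<lambda>s. 100 * \<phi> (10 * s, 10 * y)) has_real_derivative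
        100 * (frechet_derivative \<phi> (at (10 * x, 10 * y)) (1, 0) * 10)) (at x)"
      by (intro DERIV_cmult DERIV_chain2[where f = "\<lambda>s. \<phi> (s, 10 * y)"])
    then show ?thesis unfolding \<psi> \<psi>1_def by (simp add: mult_ac)
  qed
  have s\<psi>: "\<psi> x = 0" if "norm x \<ge> 1 / 500" for x unfolding \<psi> using s\<phi>[of "10 *\<^sub>R x"] that by simp
  have even\<psi>: "\<psi> (- x) = \<psi> x" for x unfolding \<psi> using even\<phi>[of "10 *\<^sub>R x"] by simp
  let ?box = "cbox (-1, -1) (1, 1) :: plane set"
  have box: "\<phi> y = 0" if "y \<notin> ?box" for y
  proof (rule s\<phi>, rule ccontr)
    assume "\<not> 1 / 50 \<le> norm y"
    then have "\<bar>fst y\<bar> < 1" "\<bar>snd y\<bar> < 1"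
      using norm_fst_le[of "fst y" "snd y"] norm_snd_le[of "snd y" "fst y"] by auto
    then show False using that by (cases y) (auto simp: cbox_Pair_eq)
  qed
  define f where "f = convolve \<phi> \<psi>"
  \<comment> \<open>The derivative of the convolution falls on \<open>\<psi>\<close>, the factor
    whose argument contains \<open>x\<close>.\<close>
  define f1 where "f1 x = integral ?box (\<lambda>y. \<phi> y * \<psi>1 (x - y))" for x
  have c1: "continuous_on UNIV (\<lambda>y. \<phi> y * \<psi> (x - y))" for x
    by (intro continuous_intros continuous_on_compose2[OF c\<psi>] c\<phi>) auto
  have f: "f x = integral ?box (\<lambda>y. \<phi> y * \<psi> (x - y))" for x
    unfolding f_def convolve_def by (rule lborel_integral_eq_integral_cbox[OF c1]) (simp add: box)
  have cf: "continuous_on UNIV f"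
    unfolding f
    by (rule integral_continuous_on_param)
      (auto simp: case_prod_unfold intro!: continuous_intros continuous_on_compose2[OF c\<phi>] continuous_on_compose2[OF c\<psi>])
  have cf1: "continuous_on UNIV f1"
    unfolding f1_def
    by (rule integral_continuous_on_param)
      (auto simp: case_prod_unfold intro!: continuous_intros continuous_on_compose2[OF c\<phi>] continuous_on_compose2[OF c\<psi>1])
  have df: "((\<lambda>x. f (x, y)) has_real_derivative f1 (x, y)) (at x)" for x y
    unfolding f f1_def
  proof (rule leibniz_rule_field_derivative[of UNIV, simplified])
    fix x and z :: plane
    have "((\<lambda>s. \<psi> (s - fst z, y - snd z)) has_real_derivative \<psi>1 (x - fst z, y - snd z)) (at x)"
      using d\<psi>[of "y - snd z" "x - fst z"] DERIV_shift[of "\<lambda>s. \<psi> (s, y - snd z)" _ x "- fst z"] by simp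
    then show "((\<lambda>x. \<phi> z * \<psi> ((x, y) - z)) has_real_derivative \<phi> z * \<psi>1 ((x, y) - z)) (at x)"
      by (cases z) (auto intro!: DERIV_cmult)
    show "(\<lambda>z. \<phi> z * \<psi> ((x, y) - z)) integrable_on ?box"
      by (rule integrable_continuous) (rule continuous_on_subset[OF c1], simp)
  next
    show "continuous_on (UNIV \<times> ?box) (\<lambda>(x, z). \<phi> z * \<psi>1 ((x, y) - z))"
      by (auto simp: case_prod_unfold intro!: continuous_intros continuous_on_compose2[OF c\<phi>] continuous_on_compose2[OF c\<psi>1])
  qed
  \<comment> \<open>The supports have radii at most \<open>1 / 50\<close> and
    \<open>1 / 500\<close>, and their sum is below \<open>1 / 40\<close>.\<close>
  have sf: "f x = 0" if "norm x \<ge> 1 / 40" for x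
  proof -
    have "\<phi> y * \<psi> (x - y) = 0" for y
    proof (cases "norm y \<ge> 1 / 50")
      case False
      then have "norm (x - y) \<ge> 1 / 500" using that norm_triangle_ineq2[of x y] by simp
      then show ?thesis using s\<psi> by simp
    qed (simp add: s\<phi>)
    then have "(\<lambda>y. \<phi> y * \<psi> (x - y)) = (\<lambda>_. 0)" by blast
    then show ?thesis unfolding f by simp
  qed
  have evenf: "f (- x) = f x" for x
  proof -
    have "(LINT y|lborel. \<phi> (- y) * \<psi> (- x - - y)) = (LINT y|lborel. \<phi> y * \<psi> (- x - y))"
      by (rule lborel_integral_uminus_plane[OF c1, of ?box]) (auto simp: box)
    moreover have "\<phi> (- y) * \<psi> (- x - - y) = \<phi> y * \<psi> (x - y)" for y
      using even\<phi>[of y] even\<psi>[of "x - y"] by simp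
    ultimately show ?thesis unfolding f_def convolve_def by simp
  qed
  define b where "b t = (LINT s|lborel. f (t, s))" for t
  define b1 where "b1 t = integral {-1..1} (\<lambda>s. f1 (t, s))" for t
  have cfs: "continuous_on S (\<lambda>s. f (t, s))" for t S
    by (intro continuous_on_compose2[OF cf] continuous_intros) auto
  have ble: "f (t, s) = 0" if "\<bar>t\<bar> \<ge> 1 / 40 \<or> \<bar>s\<bar> \<ge> 1 / 40" for t s
    using that norm_fst_le[of t s] norm_snd_le[of s t] by (intro sf) auto
  have b: "b t = integral {-1..1} (\<lambda>s. f (t, s))" for t
    unfolding b_def interval_cbox
  proof (rule lborel_integral_eq_integral_cbox[OF cfs])
    fix s :: real assume "s \<notin> cbox (-1) 1"
    then have "\<bar>s\<bar> \<ge> 1 / 40" by auto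
    then show "f (t, s) = 0" by (intro ble) simp
  qed
  have db: "(b has_real_derivative b1 t) (at t)" for t
    unfolding b b1_def interval_cbox
  proof (rule leibniz_rule_field_derivative[of UNIV, simplified])
    show "((\<lambda>x. f (x, s)) has_real_derivative f1 (x, s)) (at x)" for x s by (rule df)
    show "(\<lambda>s. f (x, s)) integrable_on cbox (-1) 1" for x
      by (rule integrable_continuous[OF cfs])
    show "continuous_on (UNIV \<times> cbox (-1) 1) (\<lambda>(x, s). f1 (x, s))"
      by (auto intro: continuous_on_subset[OF cf1])
  qed
  have cb1: "continuous_on UNIV b1"
    unfolding b1_def interval_cbox
    by (rule integral_continuous_on_param) (auto intro: continuous_on_subset[OF cf1])
  have cb: "continuous_on UNIV b" by (meson DERIV_continuous_on db has_field_derivative_at_within)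
  have cbs: "continuous_on S (\<lambda>r. b (t + r))" for t S
    by (intro continuous_on_compose2[OF cb] continuous_intros) auto
  have evenb: "b (- t) = b t" for t
    unfolding b_def using lborel_integral_uminus[of "\<lambda>s. f (- t, s)"] evenf[of "(t, s)" for s] by simp
  have sb: "b t = 0" if "\<bar>t\<bar> \<ge> 1 / 40" for t unfolding b_def using ble that by simp
  have \<eta>L: "eta \<phi> t = (LINT r|lborel. indicator {-1/2..1/2} r * b (t + r))" for t
    unfolding eta_def b_def f_def \<psi>_def set_lebesgue_integral_def by simp
  have \<eta>: "eta \<phi> t = integral {-1/2..1/2} (\<lambda>r. b (t + r))" for t
  proof -
    have "set_integrable lborel {-1/2..1/2} (\<lambda>r. b (t + r))"
      by (rule borel_integrable_atLeastAtMost'[OF cbs])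
    from set_borel_integral_eq_integral(2)[OF this] show ?thesis
      unfolding \<eta>L set_lebesgue_integral_def by simp
  qed
  \<comment> \<open>Differentiating under the integral and integrating back in \<open>r\<close>
    leaves boundary values of \<open>b\<close>, which can be differentiated once more.\<close>
  define \<eta>1 where "\<eta>1 t = b (t + 1 / 2) - b (t - 1 / 2)" for t
  define \<eta>2 where "\<eta>2 t = b1 (t + 1 / 2) - b1 (t - 1 / 2)" for t
  show thesis
  proof (rule that)
    fix t :: real
    have dbs': "((\<lambda>t. b (t + r)) has_real_derivative b1 (t + r)) (at t)" for t r
      using db[of "t + r"] by (simp add: DERIV_shift)
    have dbs: "((\<lambda>r. b (t + r)) has_real_derivative b1 (t + r)) (at r)" for t r
      using dbs'[of t r] by (simp add: add.commute)
    have "((\<lambda>t. integral {-1/2..1/2} (\<lambda>r. b (t + r))) has_real_derivative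
        integral {-1/2..1/2} (\<lambda>r. b1 (t + r))) (at t)"
      unfolding interval_cbox
    proof (rule leibniz_rule_field_derivative[of UNIV, simplified])
      show "((\<lambda>t. b (t + r)) has_real_derivative b1 (t + r)) (at t)" for t r by (rule dbs')
      show "(\<lambda>r. b (t + r)) integrable_on cbox (-1/2) (1/2)" for t
        by (rule integrable_continuous[OF cbs])
      show "continuous_on (UNIV \<times> cbox (-1/2) (1/2)) (\<lambda>(t, r). b1 (t + r))"
        by (auto simp: case_prod_unfold intro!: continuous_intros continuous_on_compose2[OF cb1])
    qed
    moreover have "((\<lambda>r. b1 (t + r)) has_integral (b (t + 1 / 2) - b (t + - 1 / 2))) {-1/2..1/2}"
      by (rule fundamental_theorem_of_calculus)
        (auto simp: has_real_derivative_iff_has_vector_derivative[symmetric]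
          intro!: has_field_derivative_at_within dbs)
    ultimately show "(eta \<phi> has_real_derivative \<eta>1 t) (at t)"
      unfolding \<eta> \<eta>1_def by (simp add: integral_unique)
    show "(\<eta>1 has_real_derivative \<eta>2 t) (at t)"
      unfolding \<eta>1_def \<eta>2_def using DERIV_diff[OF dbs'[of "1/2" t] dbs'[of "-1/2" t]] by simp
    show "continuous_on UNIV \<eta>2"
      unfolding \<eta>2_def by (intro continuous_intros continuous_on_compose2[OF cb1]) auto
    show "eta \<phi> t = 0" if "\<bar>t\<bar> > 1"
    proof -
      have "indicator {-1/2..1/2} r * b (t + r) = 0" for r
      proof (cases "r \<in> {-1/2..1/2}")
        case True
        then have "\<bar>t + r\<bar> \<ge> 1 / 40" using that unfolding atLeastAtMost_iff by linarith
        then show ?thesis using sb by simp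
      qed simp
      then show ?thesis unfolding \<eta>L by (simp only: Bochner_Integration.integral_zero)
    qed
    have "(LINT r|lborel. indicator {-1/2..1/2} (- r) * b (- t + - r)) = eta \<phi> (- t)"
      unfolding \<eta>L by (rule lborel_integral_uminus[of "\<lambda>r. indicator {-1/2..1/2} r * b (- t + r)"])
    moreover have "indicator {-1/2..1/2} (- r) * b (- t + - r) = indicator {-1/2..1/2} r * b (t + r)" for r
      using evenb[of "t + r"] by (auto simp: indicator_def)
    ultimately show "eta \<phi> (- t) = eta \<phi> t" unfolding \<eta>L by (simp only:)
  qed
qed

lemma continuous_compact_support_bounded:
  fixes f :: "real \<Rightarrow> real"
  assumes "continuous_on UNIV f" "\<And>x. \<bar>x\<bar> > 1 \<Longrightarrow> f x = 0"
  obtains K where "\<And>x. \<bar>f x\<bar> \<le> K"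
proof -
  have "compact (f ` {-1..1})"
    by (intro compact_continuous_image continuous_on_subset[OF assms(1)]) auto
  then have "bounded (f ` {-1..1})" by (rule compact_imp_bounded)
  then obtain K where K: "\<forall>x\<in>{-1..1}. \<bar>f x\<bar> \<le> K"
    unfolding bounded_iff by auto
  have "\<bar>f x\<bar> \<le> K" for x
  proof (cases "\<bar>x\<bar> > 1")
    case True
    then show ?thesis using assms(2)[of x] bspec[OF K, of 0] by simp
  next
    case False
    then have "x \<in> {-1..1}" by auto
    then show ?thesis using K by blast
  qed
  then show thesis by (rule that)
qed

text \<open>The mean of \<open>k\<close> vanishes because the substitution of \<open>10 * u\<close>
  divides the integral of \<open>eta\<close> by 10, cancelling the factor 10. Its derivatives have
  mean zero because \<open>k\<close> and \<open>k'\<close> have compact support.\<close>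

lemma eta_difference_profile:
  assumes "radial_bump \<phi>"
  obtains k k' k'' K where
    "\<And>u. k u = eta \<phi> u - 10 * eta \<phi> (10 * u)" "\<And>u. k (- u) = k u"
    "mean_zero_profile k K" "mean_zero_profile k' K" "mean_zero_profile k'' K"
    "\<And>u. (k has_real_derivative k' u) (at u)" "\<And>u. (k' has_real_derivative k'' u) (at u)"
proof -
  obtain \<eta>1 \<eta>2 where d: "\<And>x. (eta \<phi> has_real_derivative \<eta>1 x) (at x)"
      "\<And>x. (\<eta>1 has_real_derivative \<eta>2 x) (at x)"
    and c: "continuous_on UNIV \<eta>2" and s: "\<And>x. \<bar>x\<bar> > 1 \<Longrightarrow> eta \<phi> x = 0"
    and ev: "\<And>x. eta \<phi> (- x) = eta \<phi> x"
    by (rule eta_C2[OF assms]) blast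
  define k where "k u = eta \<phi> u - 10 * eta \<phi> (10 * u)" for u
  define k' where "k' u = \<eta>1 u - 100 * \<eta>1 (10 * u)" for u
  define k'' where "k'' u = \<eta>2 u - 1000 * \<eta>2 (10 * u)" for u
  have ten: "((\<lambda>u. 10 * u) has_real_derivative 10) (at u)" for u :: real
    by (auto intro!: derivative_eq_intros)
  have dk: "(k has_real_derivative k' u) (at u)" for u
    unfolding k_def k'_def
    using DERIV_diff[OF d(1)[of u] DERIV_cmult[OF DERIV_chain2[OF d(1) ten], of 10 u]] by (simp add: mult_ac)
  have dk': "(k' has_real_derivative k'' u) (at u)" for u
    unfolding k'_def k''_def
    using DERIV_diff[OF d(2)[of u] DERIV_cmult[OF DERIV_chain2[OF d(2) ten], of 100 u]] by (simp add: mult_ac)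
  have c0: "continuous_on UNIV (eta \<phi>)" by (meson DERIV_continuous_on d(1) has_field_derivative_at_within)
  have ck: "continuous_on UNIV k" by (meson DERIV_continuous_on dk has_field_derivative_at_within)
  have ck': "continuous_on UNIV k'" by (meson DERIV_continuous_on dk' has_field_derivative_at_within)
  have ck'': "continuous_on UNIV k''"
    unfolding k''_def by (intro continuous_intros c continuous_on_compose2[OF c]) auto
  have sk: "k u = 0" if "\<bar>u\<bar> > 1" for u
    unfolding k_def using that s[of u] s[of "10 * u"] by (simp add: abs_mult)
  have sk': "k' u = 0" if "\<bar>u\<bar> > 1" for u by (rule derivative_eq_0_outside[OF dk sk that])
  have sk'': "k'' u = 0" if "\<bar>u\<bar> > 1" for u by (rule derivative_eq_0_outside[OF dk' sk' that])
  have i0: "integrable lborel (eta \<phi>)"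
  proof (rule integrable_continuous_compact_support[OF c0])
    show "compact {-1..1::real}" by simp
    show "eta \<phi> x = 0" if "x \<notin> {-1..1}" for x using that by (intro s) auto
  qed
  have i10: "integrable lborel (\<lambda>u. eta \<phi> (10 * u))"
    using lborel_integrable_real_affine[OF i0, of 10 0] by simp
  have "(LINT u|lborel. k u) = (LINT u|lborel. eta \<phi> u) - 10 * (LINT u|lborel. eta \<phi> (10 * u))"
    unfolding k_def using i0 i10 by simp
  also have "(LINT u|lborel. eta \<phi> (10 * u)) = (LINT u|lborel. eta \<phi> u) / 10"
    using lborel_integral_affine_image[of 10 "eta \<phi>" 0] by simp
  finally have m: "(LINT u|lborel. k u) = 0" by simp
  have m': "(LINT u|lborel. k' u) = 0" by (rule lborel_integral_derivative_eq_0[OF dk ck' sk sk'])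
  have m'': "(LINT u|lborel. k'' u) = 0" by (rule lborel_integral_derivative_eq_0[OF dk' ck'' sk' sk''])
  obtain K0 K1 K2 where K: "\<And>u. \<bar>k u\<bar> \<le> K0" "\<And>u. \<bar>k' u\<bar> \<le> K1" "\<And>u. \<bar>k'' u\<bar> \<le> K2"
    using continuous_compact_support_bounded[OF ck sk] continuous_compact_support_bounded[OF ck' sk']
      continuous_compact_support_bounded[OF ck'' sk''] by metis
  define K where "K = max K0 (max K1 K2)"
  have "\<bar>k u\<bar> \<le> K" "\<bar>k' u\<bar> \<le> K" "\<bar>k'' u\<bar> \<le> K" for u
    unfolding K_def using K by (meson max.coboundedI1 max.coboundedI2)+
  then have "mean_zero_profile k K" "mean_zero_profile k' K" "mean_zero_profile k'' K"
    using ck ck' ck'' sk sk' sk'' m m' m'' unfolding mean_zero_profile_def by blast+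
  moreover have "k (- u) = k u" for u unfolding k_def using ev[of u] ev[of "10 * u"] by simp
  ultimately show thesis using that[of k K k' k''] k_def dk dk' by metis
qed

section \<open>Splitting the lines into two classes and normalizing\<close>

theorem theorem3p1:
  fixes \<phi> :: "plane \<Rightarrow> real"
  assumes "radial_bump \<phi>"
  shows "\<forall>W>0. \<exists>C>0. \<forall>(w::real) (P::plane set) (L::plane set set).
    0 < w \<longrightarrow> w \<le> W \<longrightarrow>
    finite P \<longrightarrow> P \<noteq> {} \<longrightarrow> P \<subseteq> unit_square \<longrightarrow>
    finite L \<longrightarrow> L \<noteq> {} \<longrightarrow> (\<forall>l\<in>L. is_line l) \<longrightarrow>
    \<bar>norm_incidences \<phi> w P L - norm_incidences \<phi> (w / 10) P L\<bar>
      \<le> C * sqrt (real (max_points P w) / real (card P)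
                  * (real (max_lines L w) / real (card L)) * w powi (-3))"
proof (intro allI impI)
  fix W :: real assume W: "0 < W"
  obtain k k' k'' K where k: "\<And>u. k u = eta \<phi> u - 10 * eta \<phi> (10 * u)" "\<And>u. k (- u) = k u"
    and prof: "mean_zero_profile k K" "mean_zero_profile k' K" "mean_zero_profile k'' K"
    and dk: "\<And>u. (k has_real_derivative k' u) (at u)" "\<And>u. (k' has_real_derivative k'' u) (at u)"
    by (rule eta_difference_profile[OF assms]) blast
  \<comment> \<open>Evenness replaces the distance to a line by the signed distance, which is affine
    in the point.\<close>
  have kabs: "k \<bar>u\<bar> = k u" for u using k(2)[of u] by (simp add: abs_if)
  define C0 where "C0 = 3 * sqrt (mean_zero_profile.energy_const K (2 * (1 + W)))"
  have "0 \<le> mean_zero_profile.energy_const K (2 * (1 + W))"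
    using W unfolding mean_zero_profile.energy_const_def[OF prof(1)] by simp
  then have C0: "0 \<le> C0" unfolding C0_def by simp
  \<comment> \<open>One \<open>C0\<close> for each of the two classes of lines; the extra 1 makes
    the constant positive.\<close>
  have main: "\<bar>norm_incidences \<phi> w P L - norm_incidences \<phi> (w / 10) P L\<bar>
      \<le> (2 * C0 + 1) * sqrt (real (max_points P w) / real (card P)
                  * (real (max_lines L w) / real (card L)) * w powi (-3))"
    if w: "0 < w" "w \<le> W" and P: "finite P" "P \<noteq> {}" "P \<subseteq> unit_square"
      and L: "finite L" "L \<noteq> {}" "\<forall>l\<in>L. is_line l" for w :: real and P L
  proof -
    define S where "S = sqrt (real (card P) * real (card L) * real (max_points P w) * real (max_lines L w) / w)"
    have S0: "0 \<le> S" unfolding S_def using w by simp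
    have chart: "\<bar>\<Sum>p\<in>P. \<Sum>l\<in>I. k (infdist p l / w)\<bar> \<le> C0 * S"
      if I: "I \<subseteq> L" and uv: "coordinate_pair u v"
        and g: "\<And>l. l \<in> I \<Longrightarrow> \<exists>t c. \<bar>t\<bar> \<le> 1 \<and> l = {q. v q = t * u q + c}" for I u v
    proof -
      obtain t where t: "\<And>l. l \<in> I \<Longrightarrow> \<exists>c. \<bar>t l\<bar> \<le> 1 \<and> l = {q. v q = t l * u q + c}"
        using g by metis
      obtain c where tc: "\<And>l. l \<in> I \<Longrightarrow> \<bar>t l\<bar> \<le> 1 \<and> l = {q. v q = t l * u q + c l}"
        using t by metis
      have fI: "finite I" using I L(1) finite_subset by blast
      have e: "k (infdist p l / w) = k ((v p - t l * u p - c l) / (w * sqrt (1 + (t l)\<^sup>2)))" if "l \<in> I" for p l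
      proof -
        have "infdist p l = \<bar>v p - t l * u p - c l\<bar> / sqrt (1 + (t l)\<^sup>2)"
          using infdist_graph[OF uv, of p "t l" "c l"] tc[OF that] by metis
        then have "infdist p l / w = \<bar>(v p - t l * u p - c l) / (w * sqrt (1 + (t l)\<^sup>2))\<bar>"
          using w by (simp add: abs_mult mult.commute)
        then show ?thesis using kabs by metis
      qed
      have "\<bar>\<Sum>p\<in>P. \<Sum>l\<in>I. k ((v p - t l * u p - c l) / (w * sqrt (1 + (t l)\<^sup>2)))\<bar>
        \<le> C0 * sqrt (real (card P) * real (card I) * real (max_points P w) * real (max_lines L w) / w)"
        unfolding C0_def
      proof (rule smoothed_incidence_sum_le[OF prof dk w P(1) fI])
        show "\<bar>t l\<bar> \<le> 1" if "l \<in> I" for l using tc[OF that] by blast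
        show "0 \<le> u p \<and> u p \<le> 1" if "p \<in> P" for p
          using that P(3) uv unfolding unit_square_def coordinate_pair_def by auto
        show "card {p \<in> P. x \<le> u p \<and> u p \<le> x + w \<and> y \<le> v p \<and> v p \<le> y + w} \<le> max_points P w" for x y
          by (rule card_points_in_box_le[OF P(1) uv])
        show "card {l \<in> I. t0 \<le> t l \<and> t l < t0 + w / 5 \<and> c0 \<le> c l \<and> c l < c0 + w / 5} \<le> max_lines L w" for t0 c0
          by (rule card_graphs_in_cell_le[OF L(1) I uv w(1)]) (use tc in blast)
      qed
      also have "\<dots> \<le> C0 * S"
        unfolding S_def using C0 w card_mono[OF L(1) I]
        by (intro mult_left_mono real_sqrt_le_mono divide_right_mono mult_right_mono) auto
      finally show ?thesis using e by simp
    qed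
    define L1 where "L1 = {l \<in> L. \<exists>t c. \<bar>t\<bar> \<le> 1 \<and> l = {q. snd q = t * fst q + c}}"
    have 1: "\<bar>\<Sum>p\<in>P. \<Sum>l\<in>L1. k (infdist p l / w)\<bar> \<le> C0 * S"
      by (rule chart[of _ fst snd]) (auto simp: L1_def coordinate_pair_def)
    \<comment> \<open>Lines of slope 1 or -1 are graphs over both axes; taking the complement of
      \<open>L1\<close> counts them once.\<close>
    have 2: "\<bar>\<Sum>p\<in>P. \<Sum>l\<in>L - L1. k (infdist p l / w)\<bar> \<le> C0 * S"
    proof (rule chart[of _ snd fst])
      fix l assume l: "l \<in> L - L1"
      then have "is_line l" using L(3) by blast
      then show "\<exists>t c. \<bar>t\<bar> \<le> 1 \<and> l = {q. fst q = t * snd q + c}"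
        using l unfolding L1_def by (cases rule: is_line_imp_graph) blast+
    qed (auto simp: coordinate_pair_def)
    define X where "X = (\<Sum>p\<in>P. \<Sum>l\<in>L. k (infdist p l / w))"
    have "X = (\<Sum>p\<in>P. (\<Sum>l\<in>L - L1. k (infdist p l / w)) + (\<Sum>l\<in>L1. k (infdist p l / w)))"
      unfolding X_def using L(1) by (intro sum.cong refl sum.subset_diff) (auto simp: L1_def)
    then have X: "\<bar>X\<bar> \<le> 2 * C0 * S" using 1 2 unfolding sum.distrib by linarith
    have card: "0 < real (card P)" "0 < real (card L)" using P L by (simp_all add: card_gt_0_iff)
    define N where "N = w * real (card P) * real (card L)"
    have N: "0 < N" unfolding N_def using w card by simp
    \<comment> \<open>Normalizing by \<open>w / 10\<close> in place of \<open>w\<close> gives the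
      factor 10, and the smaller scale multiplies the argument of \<open>eta\<close> by 10. This is
      the kernel \<open>k\<close>.\<close>
    have "norm_incidences \<phi> w P L - norm_incidences \<phi> (w / 10) P L
        = incidences \<phi> w P L / N - 10 * incidences \<phi> (w / 10) P L / N"
      unfolding norm_incidences_def N_def by simp
    also have "\<dots> = (incidences \<phi> w P L - 10 * incidences \<phi> (w / 10) P L) / N"
      by (simp add: diff_divide_distrib)
    also have "incidences \<phi> w P L - 10 * incidences \<phi> (w / 10) P L = X"
      unfolding incidences_def X_def sum.cartesian_product sum_distrib_left sum_subtractf[symmetric]
      by (intro sum.cong refl) (auto simp: k(1) field_simps)
    finally have e: "norm_incidences \<phi> w P L - norm_incidences \<phi> (w / 10) P L = X / N" .
    have "S / N = sqrt (real (max_points P w) / real (card P) * (real (max_lines L w) / real (card L)) * w powi (-3))"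
    proof -
      have "S / N = sqrt (real (card P) * real (card L) * real (max_points P w) * real (max_lines L w) / w / N\<^sup>2)"
        unfolding S_def real_sqrt_divide[of _ "N\<^sup>2"] using N by simp
      also have "real (card P) * real (card L) * real (max_points P w) * real (max_lines L w) / w / N\<^sup>2
          = real (max_points P w) / real (card P) * (real (max_lines L w) / real (card L)) * (1 / w ^ 3)"
        unfolding N_def using card w by (simp add: field_simps power2_eq_square power3_eq_cube)
      also have "1 / w ^ 3 = w powi (-3)" by (simp add: power_int_minus divide_inverse)
      finally show ?thesis .
    qed
    moreover have "\<bar>X / N\<bar> \<le> (2 * C0 + 1) * (S / N)"
    proof -
      have "\<bar>X\<bar> \<le> (2 * C0 + 1) * S" using X S0 by (simp add: distrib_right)
      then show ?thesis using N by (simp add: abs_divide divide_right_mono)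
    qed
    ultimately show ?thesis unfolding e by simp
  qed
  show "\<exists>C>0. \<forall>(w::real) (P::plane set) (L::plane set set).
    0 < w \<longrightarrow> w \<le> W \<longrightarrow>
    finite P \<longrightarrow> P \<noteq> {} \<longrightarrow> P \<subseteq> unit_square \<longrightarrow>
    finite L \<longrightarrow> L \<noteq> {} \<longrightarrow> (\<forall>l\<in>L. is_line l) \<longrightarrow>
    \<bar>norm_incidences \<phi> w P L - norm_incidences \<phi> (w / 10) P L\<bar>
      \<le> C * sqrt (real (max_points P w) / real (card P)
                  * (real (max_lines L w) / real (card L)) * w powi (-3))"
    using C0 main by (intro exI[of _ "2 * C0 + 1"]) auto
qed

end
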